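(* Every ergodic boolean action of a Polish Lévy group is whirly.
   Context: $(X,\mathcal{X},\mu)$ is a standard Borel space with a probability measure $\mu$; elements of $\mathcal{X}$ are identified modulo $\mu$-null sets. $\mathrm{Aut}(X)=\mathrm{Aut}(X,\mathcal{X},\mu)$ is the Polish group of equivalence classes (mod null sets) of invertible measure preserving transformations, with the topology whose neighborhoods of the identity are generated by the sets $\{T:\mu(A\triangle TA)<\varepsilon\}$, $A\in\mathcal{X}$, $\varepsilon>0$. A boolean action of a Polish group $G$ on $(X,\mathcal{X},\mu)$ is a continuous homomorphism $G\to\mathrm{Aut}(X)$; it is ergodic if every $A\in\mathcal{X}$ with $gA=A$ for all $g\in G$ has measure $0$ or $1$. It is whirly if for all $A,B\in\mathcal{X}$ of positive measure, every neighborhood of $e$ in $G$ contains some $g$ with $\mu(A\cap gB)>0$. A sequence $(X_n,d_n,\mu_n)$ of metric spaces with probability measures is a Lévy family if, whenever $A_n\subset X_n$ are (measurable) subsets with $\liminf\mu_n(A_n)>0$, then for every $\varepsilon>0$, $\lim\mu_n(B_\varepsilon(A_n))=1$, where $B_\varepsilon(A)$ is the $\varepsilon$-neighborhood of $A$. A Polish group $G$ is a Lévy group if there are compact subgroups $K_n\subset K_{n+1}$, $n\in\mathbb{N}$, of $G$ with $\bigcup_nK_n$ dense in $G$ such that $(K_n,d,m_n)$ is a Lévy family, where $m_n$ is normalized Haar measure on $K_n$ and $d$ is a right-invariant compatible metric on $G$. *)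

theory Defs
  imports "HOL-Probability.Probability" "HOL-Algebra.Coset"
begin

section \<open>Polish spaces and standard Borel probability spaces\<close>

definition polish_topology :: "'a topology \<Rightarrow> bool" where
  "polish_topology T \<longleftrightarrow> completely_metrizable_space T \<and> separable_space T"

definition borel_sets :: "'a topology \<Rightarrow> 'a set set" where
  "borel_sets T = sigma_sets (topspace T) {U. openin T U}"

definition standard_borel :: "'a measure \<Rightarrow> bool" where
  "standard_borel M \<longleftrightarrow>
     (\<exists>T. polish_topology T \<and> topspace T = space M \<and> sets M = borel_sets T)"

section \<open>The topological group of automorphisms of a measure space\<close>

text \<open>
  Only the restriction of \<^term>\<open>f\<close> to \<^term>\<open>space M\<close> is relevant. Requiring bijectivity
  everywhere on \<^term>\<open>space M\<close>, rather than between conull subsets, does not change the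
  group of classes: given a bijection between conull Borel sets, restrict it to an invariant
  conull Borel set and extend by the identity.
\<close>

definition mpt :: "'a measure \<Rightarrow> ('a \<Rightarrow> 'a) set" where
  "mpt M = {f \<in> measurable M M. bij_betw f (space M) (space M) \<and>
              the_inv_into (space M) f \<in> measurable M M \<and> distr M M f = M}"

definition mpt_rel :: "'a measure \<Rightarrow> (('a \<Rightarrow> 'a) \<times> ('a \<Rightarrow> 'a)) set" where
  "mpt_rel M = {(f, g). f \<in> mpt M \<and> g \<in> mpt M \<and> (AE x in M. f x = g x)}"

definition Aut :: "'a measure \<Rightarrow> ('a \<Rightarrow> 'a) set monoid" where
  "Aut M = \<lparr>carrier = mpt M // mpt_rel M,
            mult = (\<lambda>a b. \<Union>f\<in>a. \<Union>g\<in>b. mpt_rel M `` {f \<circ> g}),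
            one = mpt_rel M `` {id}\<rparr>"

text \<open>
  The image of a measurable set under an automorphism class. It depends on the chosen
  representative only up to a null set (see \<open>aut_image_AE_eq\<close> below), and it is only ever used
  inside a measure.
\<close>

definition aut_image :: "('a \<Rightarrow> 'a) set \<Rightarrow> 'a set \<Rightarrow> 'a set" where
  "aut_image a A = (SOME f. f \<in> a) ` A"

definition aut_nhd :: "'a measure \<Rightarrow> 'a set \<Rightarrow> real \<Rightarrow> ('a \<Rightarrow> 'a) set set" where
  "aut_nhd M A \<epsilon> = {a \<in> carrier (Aut M). measure M (sym_diff A (aut_image a A)) < \<epsilon>}"

text \<open>
  The group topology whose neighbourhoods of the identity are generated by the sets
  \<^term>\<open>aut_nhd M A \<epsilon>\<close>: their left translates form a subbase.
\<close>

definition Aut_topology :: "'a measure \<Rightarrow> ('a \<Rightarrow> 'a) set topology" where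
  "Aut_topology M = topology_generated_by
     {a <#\<^bsub>Aut M\<^esub> aut_nhd M A \<epsilon> | a A \<epsilon>. a \<in> carrier (Aut M) \<and> A \<in> sets M \<and> 0 < \<epsilon>}"

section \<open>Polish groups and boolean actions\<close>

definition topological_group :: "('g, 'b) monoid_scheme \<Rightarrow> 'g topology \<Rightarrow> bool" where
  "topological_group G T \<longleftrightarrow>
     group G \<and> topspace T = carrier G \<and>
     continuous_map (prod_topology T T) T (\<lambda>(x, y). x \<otimes>\<^bsub>G\<^esub> y) \<and>
     continuous_map T T (\<lambda>x. inv\<^bsub>G\<^esub> x)"

definition polish_group :: "('g, 'b) monoid_scheme \<Rightarrow> 'g topology \<Rightarrow> bool" where
  "polish_group G T \<longleftrightarrow> topological_group G T \<and> polish_topology T"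

definition boolean_action ::
  "('g, 'b) monoid_scheme \<Rightarrow> 'g topology \<Rightarrow> 'a measure \<Rightarrow> ('g \<Rightarrow> ('a \<Rightarrow> 'a) set) \<Rightarrow> bool" where
  "boolean_action G T M \<phi> \<longleftrightarrow> \<phi> \<in> hom G (Aut M) \<and> continuous_map T (Aut_topology M) \<phi>"

definition ergodic_action ::
  "('g, 'b) monoid_scheme \<Rightarrow> 'a measure \<Rightarrow> ('g \<Rightarrow> ('a \<Rightarrow> 'a) set) \<Rightarrow> bool" where
  "ergodic_action G M \<phi> \<longleftrightarrow>
     (\<forall>A\<in>sets M. (\<forall>g\<in>carrier G. measure M (sym_diff (aut_image (\<phi> g) A) A) = 0) \<longrightarrow>
        measure M A = 0 \<or> measure M A = 1)"

definition whirly_action ::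
  "('g, 'b) monoid_scheme \<Rightarrow> 'g topology \<Rightarrow> 'a measure \<Rightarrow> ('g \<Rightarrow> ('a \<Rightarrow> 'a) set) \<Rightarrow> bool" where
  "whirly_action G T M \<phi> \<longleftrightarrow>
     (\<forall>A\<in>sets M. \<forall>B\<in>sets M. 0 < measure M A \<longrightarrow> 0 < measure M B \<longrightarrow>
        (\<forall>U. openin T U \<and> \<one>\<^bsub>G\<^esub> \<in> U \<longrightarrow> (\<exists>g\<in>U. 0 < measure M (A \<inter> aut_image (\<phi> g) B))))"

section \<open>Levy groups\<close>

definition metric_nhd :: "'a set \<Rightarrow> ('a \<Rightarrow> 'a \<Rightarrow> real) \<Rightarrow> real \<Rightarrow> 'a set \<Rightarrow> 'a set" where
  "metric_nhd X d \<epsilon> A = (\<Union>a\<in>A. Metric_space.mball X d a \<epsilon>)"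

definition levy_family ::
  "(nat \<Rightarrow> 'a set) \<Rightarrow> (nat \<Rightarrow> 'a \<Rightarrow> 'a \<Rightarrow> real) \<Rightarrow> (nat \<Rightarrow> 'a measure) \<Rightarrow> bool" where
  "levy_family X d \<mu> \<longleftrightarrow>
     (\<forall>n. Metric_space (X n) (d n) \<and> prob_space (\<mu> n) \<and> space (\<mu> n) = X n \<and>
          sets (\<mu> n) = borel_sets (Metric_space.mtopology (X n) (d n))) \<and>
     (\<forall>A. (\<forall>n. A n \<in> sets (\<mu> n)) \<and> 0 < liminf (\<lambda>n. emeasure (\<mu> n) (A n)) \<longrightarrow>
        (\<forall>\<epsilon>>0. (\<lambda>n. measure (\<mu> n) (metric_nhd (X n) (d n) \<epsilon> (A n))) \<longlonglongrightarrow> 1))"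

definition normalized_haar ::
  "('g, 'b) monoid_scheme \<Rightarrow> 'g topology \<Rightarrow> 'g set \<Rightarrow> 'g measure \<Rightarrow> bool" where
  "normalized_haar G T K m \<longleftrightarrow>
     prob_space m \<and> space m = K \<and> sets m = borel_sets (subtopology T K) \<and>
     (\<forall>g\<in>K. \<forall>A\<in>sets m. emeasure m (g <#\<^bsub>G\<^esub> A) = emeasure m A)"

definition compatible_metric :: "'a topology \<Rightarrow> ('a \<Rightarrow> 'a \<Rightarrow> real) \<Rightarrow> bool" where
  "compatible_metric T d \<longleftrightarrow>
     Metric_space (topspace T) d \<and> Metric_space.mtopology (topspace T) d = T"

definition right_invariant :: "('g, 'b) monoid_scheme \<Rightarrow> ('g \<Rightarrow> 'g \<Rightarrow> real) \<Rightarrow> bool" where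
  "right_invariant G d \<longleftrightarrow>
     (\<forall>x\<in>carrier G. \<forall>y\<in>carrier G. \<forall>g\<in>carrier G. d (x \<otimes>\<^bsub>G\<^esub> g) (y \<otimes>\<^bsub>G\<^esub> g) = d x y)"

text \<open>
  The measures \<^term>\<open>m n\<close> are determined by \<^term>\<open>K n\<close> (uniqueness of Haar measure), and the
  property does not depend on the metric \<^term>\<open>d\<close>, since any two right-invariant compatible metrics
  on a topological group are uniformly equivalent.
\<close>

definition levy_group :: "('g, 'b) monoid_scheme \<Rightarrow> 'g topology \<Rightarrow> bool" where
  "levy_group G T \<longleftrightarrow>
     (\<exists>K m d. (\<forall>n. subgroup (K n) G \<and> compactin T (K n) \<and> K n \<subseteq> K (Suc n)) \<and>
        T closure_of (\<Union>n. K n) = carrier G \<and>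
        (\<forall>n. normalized_haar G T (K n) (m n)) \<and>
        compatible_metric T d \<and> right_invariant G d \<and>
        levy_family K (\<lambda>n. d) m)"

section \<open>Well-definedness\<close>

lemma mpt_comp:
  assumes f: "f \<in> mpt M" and g: "g \<in> mpt M"
  shows "f \<circ> g \<in> mpt M"
proof -
  have [measurable]: "f \<in> measurable M M" "g \<in> measurable M M"
    "the_inv_into (space M) f \<in> measurable M M" "the_inv_into (space M) g \<in> measurable M M"
    using f g by (auto simp: mpt_def)
  have bf: "bij_betw f (space M) (space M)" and bg: "bij_betw g (space M) (space M)"
    using f g by (auto simp: mpt_def)
  have "the_inv_into (space M) (f \<circ> g) y = the_inv_into (space M) g (the_inv_into (space M) f y)"
    if "y \<in> space M" for y
    using the_inv_into_comp[of f g "space M" y] bf bg that by (auto simp: bij_betw_def)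
  moreover have "(\<lambda>y. the_inv_into (space M) g (the_inv_into (space M) f y)) \<in> measurable M M"
    by measurable
  ultimately have "the_inv_into (space M) (f \<circ> g) \<in> measurable M M"
    by (subst measurable_cong) auto
  moreover have "distr M M (f \<circ> g) = M"
    using distr_distr[of f M M g M] f g by (auto simp: mpt_def)
  ultimately show ?thesis
    using bij_betw_trans[OF bg bf] by (auto simp: mpt_def)
qed

lemma mpt_AE:
  assumes "f \<in> mpt M" "AE x in M. P x"
  shows "AE x in M. P (f x)"
proof -
  obtain N where N: "N \<in> null_sets M" "{x \<in> space M. \<not> P x} \<subseteq> N"
    using assms(2) by (auto simp: eventually_ae_filter)
  have [measurable]: "f \<in> measurable M M" and d: "distr M M f = M"
    using assms(1) by (auto simp: mpt_def)
  have "emeasure M (f -` N \<inter> space M) = emeasure (distr M M f) N"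
    using N by (subst emeasure_distr) auto
  then have "f -` N \<inter> space M \<in> null_sets M"
    using N d measurable_sets[of f M M N] by (auto intro!: null_setsI)
  moreover have "{x \<in> space M. \<not> P (f x)} \<subseteq> f -` N \<inter> space M"
    using N measurable_space[of f M M] by auto
  ultimately show ?thesis
    by (rule AE_I')
qed

lemma mpt_image_sets:
  assumes "f \<in> mpt M" "A \<in> sets M"
  shows "f ` A \<in> sets M"
proof -
  have "bij_betw f (space M) (space M)" and "the_inv_into (space M) f \<in> measurable M M"
    using assms by (auto simp: mpt_def)
  moreover from this have "f ` A = the_inv_into (space M) f -` A \<inter> space M"
    using sets.sets_into_space[OF assms(2)]
    by (auto simp: bij_betw_def the_inv_into_f_f subset_iff)
       (metis f_the_inv_into_f image_eqI)
  ultimately show ?thesis using assms by (auto intro: measurable_sets)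
qed

lemma equiv_mpt_rel: "equiv (mpt M) (mpt_rel M)"
proof (rule equivI)
  show "sym (mpt_rel M)"
    by (auto simp: sym_def mpt_rel_def elim: eventually_mono)
  show "trans (mpt_rel M)"
  proof (rule transI)
    fix f g h assume 1: "(f, g) \<in> mpt_rel M" and 2: "(g, h) \<in> mpt_rel M"
    then have "AE x in M. f x = g x" "AE x in M. g x = h x" by (auto simp: mpt_rel_def)
    then have "AE x in M. f x = h x" by eventually_elim simp
    with 1 2 show "(f, h) \<in> mpt_rel M" by (auto simp: mpt_rel_def)
  qed
qed (auto simp: refl_on_def mpt_rel_def)

lemma mpt_rel_comp:
  assumes "(f, f') \<in> mpt_rel M" "(g, g') \<in> mpt_rel M"
  shows "(f \<circ> g, f' \<circ> g') \<in> mpt_rel M"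
proof -
  have *: "f \<in> mpt M" "f' \<in> mpt M" "g \<in> mpt M" "g' \<in> mpt M"
    and "AE x in M. f x = f' x" and 2: "AE x in M. g x = g' x"
    using assms by (auto simp: mpt_rel_def)
  then have "AE x in M. f (g x) = f' (g x)"
    using mpt_AE[of g M "\<lambda>y. f y = f' y"] by auto
  with 2 have "AE x in M. (f \<circ> g) x = (f' \<circ> g') x"
    by eventually_elim auto
  with * show ?thesis by (auto simp: mpt_rel_def mpt_comp)
qed

lemma Aut_mult:
  assumes "f \<in> mpt M" "g \<in> mpt M"
  shows "mpt_rel M `` {f} \<otimes>\<^bsub>Aut M\<^esub> mpt_rel M `` {g} = mpt_rel M `` {f \<circ> g}"
proof -
  have "congruent2 (mpt_rel M) (mpt_rel M) (\<lambda>f g. mpt_rel M `` {f \<circ> g})"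
    by (intro congruent2I' equiv_class_eq[OF equiv_mpt_rel] mpt_rel_comp)
  from UN_equiv_class2[OF equiv_mpt_rel equiv_mpt_rel this assms] show ?thesis
    by (simp add: Aut_def)
qed

lemma mpt_image_null:
  assumes f: "f \<in> mpt M" and N: "N \<in> null_sets M"
  shows "f ` N \<in> null_sets M"
proof -
  have m: "f \<in> measurable M M" and d: "distr M M f = M" and b: "inj_on f (space M)"
    using f by (auto simp: mpt_def bij_betw_def)
  have s: "f ` N \<in> sets M" using mpt_image_sets f N by auto
  have "N \<subseteq> space M" using N sets.sets_into_space by auto
  then have "f -` (f ` N) \<inter> space M = N"
    using b by (auto simp: inj_on_def subset_iff)
  then have "emeasure (distr M M f) (f ` N) = emeasure M N"
    using m s by (simp add: emeasure_distr)
  with d s N show ?thesis by (auto simp: null_sets_def)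
qed

lemma aut_image_AE_eq:
  assumes a: "a \<in> carrier (Aut M)" and f: "f \<in> a" and A: "A \<in> sets M"
  shows "sym_diff (aut_image a A) (f ` A) \<in> null_sets M"
proof -
  define h where "h = (SOME f. f \<in> a)"
  have "h \<in> a" using someI[of "\<lambda>f. f \<in> a", OF f] by (simp add: h_def)
  then have r: "(h, f) \<in> mpt_rel M"
    using a f quotient_eq_iff[OF equiv_mpt_rel, of a M a h f] by (simp add: Aut_def)
  then have hm: "h \<in> mpt M" and fm: "f \<in> mpt M" and "AE x in M. h x = f x"
    by (auto simp: mpt_rel_def)
  then obtain N where N: "N \<in> null_sets M" "{x \<in> space M. h x \<noteq> f x} \<subseteq> N"
    by (auto simp: eventually_ae_filter)
  have "sym_diff (h ` A) (f ` A) \<subseteq> h ` N \<union> f ` N"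
    using N(2) sets.sets_into_space[OF A] by (auto simp: image_iff subset_iff) metis+
  moreover have "h ` N \<union> f ` N \<in> null_sets M"
    using mpt_image_null[OF hm N(1)] mpt_image_null[OF fm N(1)] by auto
  moreover have "sym_diff (h ` A) (f ` A) \<in> sets M"
    using mpt_image_sets[OF hm A] mpt_image_sets[OF fm A] by auto
  ultimately show ?thesis
    unfolding aut_image_def h_def[symmetric] by (rule null_sets_subset[rotated 2])
qed

lemma mpt_id: "id \<in> mpt M"
proof -
  have "the_inv_into (space M) id \<in> measurable M M"
    by (subst measurable_cong[where g = id]) (auto simp: the_inv_into_f_eq)
  moreover have "distr M M id = M" by (simp add: id_def)
  ultimately show ?thesis by (auto simp: mpt_def)
qed

lemma mpt_inv:
  assumes f: "f \<in> mpt M"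
  shows "the_inv_into (space M) f \<in> mpt M"
proof -
  let ?g = "the_inv_into (space M) f"
  have m: "f \<in> measurable M M" "?g \<in> measurable M M" and d: "distr M M f = M"
    and b: "bij_betw f (space M) (space M)"
    using f by (auto simp: mpt_def)
  have bg: "bij_betw ?g (space M) (space M)" using b by (rule bij_betw_the_inv_into)
  have "the_inv_into (space M) ?g x = f x" if "x \<in> space M" for x
    using b bg that
    by (intro the_inv_into_f_eq) (auto simp: bij_betw_def the_inv_into_f_f)
  then have "the_inv_into (space M) ?g \<in> measurable M M"
    using m(1) by (subst measurable_cong[where g = f]) auto
  moreover have "distr M M ?g = M"
  proof -
    have "distr M M ?g = distr (distr M M f) M ?g" using d by simp
    also have "\<dots> = distr M M (?g \<circ> f)" using m by (simp add: distr_distr)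
    also have "\<dots> = distr M M id"
      using b by (intro distr_cong) (auto simp: bij_betw_def the_inv_into_f_f)
    also have "\<dots> = M" by (simp add: id_def)
    finally show ?thesis .
  qed
  ultimately show ?thesis using m(2) bg by (auto simp: mpt_def)
qed

lemma group_Aut: "group (Aut M)"
proof (rule groupI)
  fix x assume "x \<in> carrier (Aut M)"
  then obtain f where f: "f \<in> mpt M" "x = mpt_rel M `` {f}"
    by (auto simp: Aut_def quotient_def)
  let ?g = "the_inv_into (space M) f"
  have "(?g \<circ> f, id) \<in> mpt_rel M"
    using f mpt_inv[OF f(1)] mpt_comp[of ?g M f] mpt_id
    by (auto simp: mpt_rel_def mpt_def bij_betw_def the_inv_into_f_f)
  then have "mpt_rel M `` {?g} \<otimes>\<^bsub>Aut M\<^esub> x = \<one>\<^bsub>Aut M\<^esub>"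
    using equiv_class_eq[OF equiv_mpt_rel] Aut_mult[OF mpt_inv[OF f(1)] f(1)] f(2)
    by (auto simp: Aut_def)
  moreover have "mpt_rel M `` {?g} \<in> carrier (Aut M)"
    using mpt_inv[OF f(1)] by (auto simp: Aut_def quotientI)
  ultimately show "\<exists>y\<in>carrier (Aut M). y \<otimes>\<^bsub>Aut M\<^esub> x = \<one>\<^bsub>Aut M\<^esub>" by blast
  show "\<one>\<^bsub>Aut M\<^esub> \<otimes>\<^bsub>Aut M\<^esub> x = x"
    using f Aut_mult[OF mpt_id f(1)] by (simp add: Aut_def)
next
  fix x y assume "x \<in> carrier (Aut M)" "y \<in> carrier (Aut M)"
  then obtain f g where fg: "f \<in> mpt M" "x = mpt_rel M `` {f}" "g \<in> mpt M" "y = mpt_rel M `` {g}"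
    by (auto simp: Aut_def quotient_def)
  then show "x \<otimes>\<^bsub>Aut M\<^esub> y \<in> carrier (Aut M)"
    using mpt_comp[of f M g] by (simp add: Aut_mult) (simp add: Aut_def quotientI)
  fix z assume "z \<in> carrier (Aut M)"
  then obtain h where "h \<in> mpt M" "z = mpt_rel M `` {h}"
    by (auto simp: Aut_def quotient_def)
  with fg show "x \<otimes>\<^bsub>Aut M\<^esub> y \<otimes>\<^bsub>Aut M\<^esub> z = x \<otimes>\<^bsub>Aut M\<^esub> (y \<otimes>\<^bsub>Aut M\<^esub> z)"
    by (simp add: Aut_mult mpt_comp comp_assoc)
next
  show "\<one>\<^bsub>Aut M\<^esub> \<in> carrier (Aut M)" by (simp add: Aut_def mpt_id quotientI)
qed

end

theory Submission
  imports Defs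
begin

text \<open>
  Suppose that the action is ergodic but not whirly: there are sets $A$ and $B$ of positive measure
  and a ball $U$ around the identity such that $A \cap gB$ is null for all $g \in U$. For a point $x$
  let $S_x$ be the set of those $g$ with $gx \in B$, and $R_x$ the set of those $g$ with $gx \in A$.
  If $g \in S_x$ and $h \in R_x$ then $hx$ lies in $A \cap (hg^{-1})B$, so for almost all $x$ this
  should force $hg^{-1} \notin U$: the sets $S_x$ and $R_x$ are at a positive distance for the
  right-invariant metric, independently of $x$. In the compact groups $K_n$ of a Levy group, this
  is impossible for large $n$ if both sets have Haar measure bounded below. It remains to find points
  $x$ (depending on $n$) for which both are large.

  The Haar measure of $S_x \cap K_n$ is the average over $K_n$ of the translates $g^{-1} 1_B$,
  evaluated at $x$. By a mean ergodic theorem (\<open>mean_ergodic_approximation\<close>), some convex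
  combination of translates of $1_B$ by elements of the dense union of the $K_n$ is close in $L^1$
  to the constant $\mu(B)$. All translates that occur are by elements of $K_n$ when $n$ is large, and
  the average over $K_n$ does not change if $1_B$ is replaced by such a combination, by left
  invariance of the Haar measure (\<open>haar_average_orbit_hull\<close>). Hence the measure of
  $S_x \cap K_n$ is close to $\mu(B)$ for most $x$. The measure of $R_x \cap K_n$ has mean $\mu(A)$, so
  it is at least $\mu(A)/4$ on a set of points which is too large to consist of exceptional points for
  $S_x$ (\<open>separated_return_sets\<close>).

  Since group elements act on points only up to null sets, $S_x$ and $R_x$ are not defined as they
  stand. Each compact group is therefore replaced by a finite set of its elements through a
  measurable rounding map that moves elements by a small distance and changes the translates of $B$
  by sets of small measure (\<open>finite_discretization\<close>). The error is absorbed in the positive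
  distance between $S_x$ and $R_x$, and all measure theory on the product of group and space
  becomes finite.
\<close>

section \<open>Measure preserving bijections and bounded functions\<close>

lemma measure_mpt_vimage:
  assumes "f \<in> mpt M" "A \<in> sets M"
  shows "measure M (f -` A \<inter> space M) = measure M A"
proof -
  have "measure M A = measure (distr M M f) A"
    using assms(1) by (simp add: mpt_def)
  also have "\<dots> = measure M (f -` A \<inter> space M)"
    using assms by (intro measure_distr) (auto simp: mpt_def)
  finally show ?thesis by simp
qed

lemma mpt_vimage_image:
  assumes "f \<in> mpt M" "A \<in> sets M"
  shows "f -` (f ` A) \<inter> space M = A"
  using assms sets.sets_into_space[OF assms(2)]
  by (auto simp: mpt_def bij_betw_def inj_on_def subset_iff)

lemma measure_Int_mpt_image:
  assumes f: "f \<in> mpt M" and A: "A \<in> sets M" and B: "B \<in> sets M"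
  shows "measure M (A \<inter> f ` B) = measure M ((f -` A \<inter> space M) \<inter> B)"
proof -
  have "measure M (A \<inter> f ` B) = measure M (f -` (A \<inter> f ` B) \<inter> space M)"
    using measure_mpt_vimage[OF f, of "A \<inter> f ` B"] A mpt_image_sets[OF f B] by auto
  also have "f -` (A \<inter> f ` B) \<inter> space M = (f -` A \<inter> space M) \<inter> B"
    using mpt_vimage_image[OF f B] by auto
  finally show ?thesis .
qed

lemma measure_sym_diff_mpt_image:
  assumes f: "f \<in> mpt M" and A: "A \<in> sets M" and B: "B \<in> sets M"
  shows "measure M (sym_diff A (f ` B)) = measure M (sym_diff (f -` A \<inter> space M) B)"
proof -
  have "measure M (sym_diff A (f ` B)) = measure M (f -` (sym_diff A (f ` B)) \<inter> space M)"
    using measure_mpt_vimage[OF f, of "sym_diff A (f ` B)"] A mpt_image_sets[OF f B] by auto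
  also have "f -` (sym_diff A (f ` B)) \<inter> space M = sym_diff (f -` A \<inter> space M) B"
    using mpt_vimage_image[OF f B] by auto
  finally show ?thesis .
qed

lemma (in prob_space) integrable_unit_interval:
  fixes u :: "'a \<Rightarrow> real"
  assumes "u \<in> borel_measurable M" "\<And>x. 0 \<le> u x \<and> u x \<le> 1"
  shows "integrable M u"
  by (rule integrable_const_bound[of _ 1]) (use assms in auto)

text \<open>
  Jensen's inequality for the square, in the form that the variance of the absolute value is
  nonnegative.
\<close>

lemma (in prob_space) integral_abs_le_sqrt:
  fixes v :: "'a \<Rightarrow> real"
  assumes [measurable]: "v \<in> borel_measurable M" and "\<And>x. \<bar>v x\<bar> \<le> 1"
    and "(\<integral>x. (v x)\<^sup>2 \<partial>M) \<le> s\<^sup>2" "0 \<le> s"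
  shows "(\<integral>x. \<bar>v x\<bar> \<partial>M) \<le> s"
proof -
  have i: "integrable M (\<lambda>x. \<bar>v x\<bar>)" "integrable M (\<lambda>x. \<bar>v x\<bar>\<^sup>2)"
    using assms(2) by (auto intro!: integrable_const_bound[of _ 1] simp: abs_square_le_1)
  have "0 \<le> variance (\<lambda>x. \<bar>v x\<bar>)" by (rule variance_positive)
  also have "\<dots> = (\<integral>x. \<bar>v x\<bar>\<^sup>2 \<partial>M) - (\<integral>x. \<bar>v x\<bar> \<partial>M)\<^sup>2"
    by (rule variance_eq[OF i])
  finally have "(\<integral>x. \<bar>v x\<bar> \<partial>M)\<^sup>2 \<le> s\<^sup>2" using assms(3) by simp
  then show ?thesis using assms(4) by (rule power2_le_imp_le)
qed

text \<open>
  This is the step in the completeness of $L^1$ that produces the pointwise limit: by monotone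
  convergence the series of increments has a finite integral, so it converges absolutely almost
  everywhere, and its partial sums telescope.
\<close>

lemma AE_convergent_of_summable_L1:
  fixes w :: "nat \<Rightarrow> 'a \<Rightarrow> real"
  assumes w: "\<And>k. integrable M (w k)"
    and c: "\<And>k. (\<integral>x. \<bar>w (Suc k) x - w k x\<bar> \<partial>M) \<le> c k" "summable c"
  shows "AE x in M. convergent (\<lambda>k. w k x)"
proof -
  note [measurable] = borel_measurable_integrable[OF w]
  have i: "integrable M (\<lambda>x. \<bar>w (Suc k) x - w k x\<bar>)" for k
    using w by auto
  have c0: "0 \<le> c k" for k
    by (rule order_trans[OF _ c(1)]) (auto intro: integral_nonneg_AE)
  have "(\<integral>\<^sup>+x. (\<Sum>k. ennreal \<bar>w (Suc k) x - w k x\<bar>) \<partial>M)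
      = (\<Sum>k. \<integral>\<^sup>+x. ennreal \<bar>w (Suc k) x - w k x\<bar> \<partial>M)"
    by (rule nn_integral_suminf) auto
  also have "\<dots> \<le> (\<Sum>k. ennreal (c k))"
    using c(1) i by (intro suminf_le) (auto simp: nn_integral_eq_integral ennreal_leI)
  also have "\<dots> = ennreal (\<Sum>k. c k)"
    using c0 c(2) by (rule suminf_ennreal2)
  finally have "(\<integral>\<^sup>+x. (\<Sum>k. ennreal \<bar>w (Suc k) x - w k x\<bar>) \<partial>M) \<noteq> \<infinity>"
    by (auto simp: top_unique)
  then have "AE x in M. (\<Sum>k. ennreal \<bar>w (Suc k) x - w k x\<bar>) \<noteq> \<infinity>"
    by (intro nn_integral_PInf_AE) auto
  then show ?thesis
  proof eventually_elim
    case (elim x)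
    then have "summable (\<lambda>k. \<bar>w (Suc k) x - w k x\<bar>)"
      by (intro summable_suminf_not_top) auto
    then have "summable (\<lambda>k. w (Suc k) x - w k x)"
      by (rule summable_rabs_cancel)
    then have "convergent (\<lambda>n. \<Sum>k<n. w (Suc k) x - w k x)"
      by (simp add: summable_iff_convergent)
    then have "convergent (\<lambda>n. w n x - w 0 x)"
      by (simp only: sum_lessThan_telescope[of "\<lambda>k. w k x"])
    then show ?case
      unfolding convergent_diff_const_right_iff .
  qed
qed

lemma integral_finite_image:
  fixes \<phi> :: "'c \<Rightarrow> real"
  assumes m: "prob_space m" and \<sigma>: "\<sigma> \<in> measurable m (count_space UNIV)"
    and fin: "finite (\<sigma> ` space m)"
  shows "(\<integral>g. \<phi> (\<sigma> g) \<partial>m) = (\<Sum>c\<in>\<sigma> ` space m. measure m (\<sigma> -` {c} \<inter> space m) * \<phi> c)"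
proof -
  interpret m: prob_space m by (rule m)
  have s: "\<sigma> -` {c} \<inter> space m \<in> sets m" for c
    using \<sigma> by (rule measurable_sets) simp
  then have [simp]: "integrable m (indicat_real (\<sigma> -` {c} \<inter> space m))" for c
    by (intro integrable_real_indicator) (auto simp: less_top[symmetric])
  have "(\<integral>g. \<phi> (\<sigma> g) \<partial>m)
      = (\<integral>g. (\<Sum>c\<in>\<sigma> ` space m. indicator (\<sigma> -` {c} \<inter> space m) g * \<phi> c) \<partial>m)"
  proof (rule Bochner_Integration.integral_cong)
    fix g assume g: "g \<in> space m"
    then have "(\<Sum>c\<in>\<sigma> ` space m. indicator (\<sigma> -` {c} \<inter> space m) g * \<phi> c)
        = (\<Sum>c\<in>\<sigma> ` space m. if c = \<sigma> g then \<phi> c else 0)"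
      by (intro sum.cong) (auto simp: indicator_def)
    also have "\<dots> = \<phi> (\<sigma> g)" using g fin by simp
    finally show "\<phi> (\<sigma> g) = (\<Sum>c\<in>\<sigma> ` space m. indicator (\<sigma> -` {c} \<inter> space m) g * \<phi> c)" by simp
  qed simp
  also have "\<dots> = (\<Sum>c\<in>\<sigma> ` space m. measure m (\<sigma> -` {c} \<inter> space m) * \<phi> c)"
    by (subst Bochner_Integration.integral_sum) (auto simp: Int_absorb2)
  finally show ?thesis .
qed

section \<open>Translation invariance of Haar integrals\<close>

lemma normalized_haarD:
  assumes "normalized_haar G T K m"
  shows "prob_space m" "space m = K" "sets m = borel_sets (subtopology T K)"
    "g \<in> K \<Longrightarrow> A \<in> sets m \<Longrightarrow> emeasure m (g <#\<^bsub>G\<^esub> A) = emeasure m A"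
  using assms by (auto simp: normalized_haar_def)

locale topological_group_on =
  fixes G :: "('g, 'b) monoid_scheme" (structure)
    and \<tau> :: "'g topology"
  assumes top_group: "topological_group G \<tau>"
begin

lemma group_G: "group G" and topspace_eq: "topspace \<tau> = carrier G"
  using top_group by (auto simp: topological_group_def)

sublocale G: group G by (rule group_G)

lemma haar_open_sets:
  assumes "normalized_haar G \<tau> K m" "openin \<tau> U"
  shows "U \<inter> K \<in> sets m"
  unfolding normalized_haarD(3)[OF assms(1)] borel_sets_def
  using assms(2) by (intro sigma_sets.Basic) (auto simp: openin_subtopology)

lemma translation_measurable:
  assumes haar: "normalized_haar G \<tau> K m" and K: "subgroup K G" and k: "k \<in> K"
  shows "(\<lambda>g. k \<otimes> g) \<in> measurable m m"
proof (rule measurable_sigma_sets[OF normalized_haarD(3)[OF haar, unfolded borel_sets_def]])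
  note sp = normalized_haarD(2)[OF haar]
  have KG: "K \<subseteq> carrier G" using K by (rule subgroup.subset)
  then have kG: "k \<in> carrier G" using k by auto
  show "{U. openin (subtopology \<tau> K) U} \<subseteq> Pow (topspace (subtopology \<tau> K))"
    using openin_subset by blast
  show "(\<lambda>g. k \<otimes> g) \<in> space m \<rightarrow> topspace (subtopology \<tau> K)"
    using subgroup.m_closed[OF K k] KG by (auto simp: sp topspace_eq)
  have "continuous_map \<tau> (prod_topology \<tau> \<tau>) (\<lambda>g. (k, g))"
    using kG by (auto simp: continuous_map_pairwise o_def topspace_eq)
  moreover have "continuous_map (prod_topology \<tau> \<tau>) \<tau> (\<lambda>(x, y). x \<otimes> y)"
    using top_group by (auto simp: topological_group_def)
  ultimately have cont: "continuous_map \<tau> \<tau> (\<lambda>g. k \<otimes> g)"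
    using continuous_map_compose by (fastforce simp: o_def)
  show "(\<lambda>g. k \<otimes> g) -` U \<inter> space m \<in> sets m" if U: "U \<in> {U. openin (subtopology \<tau> K) U}" for U
  proof -
    obtain V where V: "openin \<tau> V" "U = V \<inter> K" using U by (auto simp: openin_subtopology)
    have "(\<lambda>g. k \<otimes> g) -` U \<inter> space m = {g \<in> topspace \<tau>. k \<otimes> g \<in> V} \<inter> K"
      using V(2) subgroup.m_closed[OF K k] KG by (auto simp: sp topspace_eq)
    moreover have "openin \<tau> {g \<in> topspace \<tau>. k \<otimes> g \<in> V}"
      using cont V(1) by (rule openin_continuous_map_preimage)
    ultimately show "(\<lambda>g. k \<otimes> g) -` U \<inter> space m \<in> sets m"
      using haar_open_sets[OF haar] by simp
  qed
qed

text \<open>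
  Left translations by elements of \<^term>\<open>K\<close> preserve the normalized Haar measure on sets; this
  transfers to integrals because the translation is Borel measurable on \<^term>\<open>K\<close>, being
  continuous.
\<close>

lemma haar_integral_translate:
  fixes \<psi> :: "'g \<Rightarrow> real"
  assumes haar: "normalized_haar G \<tau> K m" and K: "subgroup K G" and k: "k \<in> K"
    and \<psi>: "\<psi> \<in> borel_measurable m"
  shows "(\<integral>g. \<psi> (k \<otimes> g) \<partial>m) = (\<integral>g. \<psi> g \<partial>m)"
proof -
  note meas = translation_measurable[OF haar K k]
  note sp = normalized_haarD(2)[OF haar]
  have KG: "K \<subseteq> carrier G" using K by (rule subgroup.subset)
  have ik: "inv k \<in> K" using K k by (rule subgroup.m_inv_closed)
  have "distr m m (\<lambda>g. k \<otimes> g) = m"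
  proof (rule measure_eqI)
    fix A assume "A \<in> sets (distr m m (\<lambda>g. k \<otimes> g))"
    then have A: "A \<in> sets m" by simp
    then have AK: "A \<subseteq> K" using sets.sets_into_space sp by blast
    have "(\<lambda>g. k \<otimes> g) -` A \<inter> space m = inv k <# A"
    proof (rule subset_antisym; rule subsetI)
      fix g assume "g \<in> (\<lambda>g. k \<otimes> g) -` A \<inter> space m"
      then have "k \<otimes> g \<in> A" "g \<in> space m" by auto
      moreover from this have "k \<in> carrier G" "g \<in> carrier G" using k KG sp by auto
      then have "g = inv k \<otimes> (k \<otimes> g)"
        by (simp add: G.m_assoc[symmetric])
      ultimately show "g \<in> inv k <# A" unfolding l_coset_def by blast
    next
      fix g assume "g \<in> inv k <# A"
      then obtain h where h: "h \<in> A" "g = inv k \<otimes> h" by (auto simp: l_coset_def)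
      then have "k \<otimes> g = h"
        using k ik KG AK by (simp add: G.m_assoc[symmetric] subset_iff)
      then show "g \<in> (\<lambda>g. k \<otimes> g) -` A \<inter> space m"
        using h AK subgroup.m_closed[OF K ik, of h] by (auto simp: sp)
    qed
    then show "emeasure (distr m m (\<lambda>g. k \<otimes> g)) A = emeasure m A"
      using meas A normalized_haarD(4)[OF haar ik A] by (simp add: emeasure_distr)
  qed simp
  then have "(\<integral>g. \<psi> g \<partial>m) = (\<integral>g. \<psi> g \<partial>(distr m m (\<lambda>g. k \<otimes> g)))" by simp
  also have "\<dots> = (\<integral>g. \<psi> (k \<otimes> g) \<partial>m)"
    using meas \<psi> by (rule integral_distr)
  finally show ?thesis by simp
qed

end

section \<open>Near actions and orbit hulls\<close>

text \<open>
  A boolean action assigns to a group element only a class of transformations. The locale works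
  with one transformation \<^term>\<open>t g\<close> for each class, so that it is multiplicative merely up to a
  null set which depends on the two group elements; uncountably many such null sets cannot be
  discarded together, and no pointwise action of \<^term>\<open>G\<close> is available. Preimages are used instead
  of images: \<^term>\<open>t g -` A \<inter> space M\<close> represents the translate of \<^term>\<open>A\<close> by the inverse
  of \<^term>\<open>g\<close>, and its indicator is simply the indicator of \<^term>\<open>A\<close> composed with \<^term>\<open>t g\<close>.
\<close>

locale near_action = prob_space M + topological_group_on G \<tau>
  for M :: "'x measure"
    and G :: "('g, 'b) monoid_scheme" (structure)
    and \<tau> :: "'g topology" +
  fixes t :: "'g \<Rightarrow> 'x \<Rightarrow> 'x"
  assumes t_mpt: "g \<in> carrier G \<Longrightarrow> t g \<in> mpt M"
    and t_mult: "g \<in> carrier G \<Longrightarrow> h \<in> carrier G \<Longrightarrow> AE x in M. t (g \<otimes> h) x = t g (t h x)"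
    and t_cont: "A \<in> sets M \<Longrightarrow> g \<in> carrier G \<Longrightarrow> 0 < e \<Longrightarrow>
      openin \<tau> {h \<in> carrier G.
        prob (sym_diff (t h -` A \<inter> space M) (t g -` A \<inter> space M)) < e}"
begin

abbreviation pre :: "'g \<Rightarrow> 'x set \<Rightarrow> 'x set" where
  "pre g A \<equiv> t g -` A \<inter> space M"

lemma t_measurable [measurable]: "g \<in> carrier G \<Longrightarrow> t g \<in> measurable M M"
  using t_mpt by (auto simp: mpt_def)

lemma pre_sets [measurable]: "g \<in> carrier G \<Longrightarrow> A \<in> sets M \<Longrightarrow> pre g A \<in> sets M"
  by (rule measurable_sets[OF t_measurable])

lemma prob_pre: "g \<in> carrier G \<Longrightarrow> A \<in> sets M \<Longrightarrow> prob (pre g A) = prob A"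
  using measure_mpt_vimage t_mpt by blast

lemma integral_t:
  fixes u :: "'x \<Rightarrow> real"
  assumes "g \<in> carrier G" "u \<in> borel_measurable M"
  shows "(\<integral>x. u (t g x) \<partial>M) = (\<integral>x. u x \<partial>M)"
proof -
  have "(\<integral>x. u x \<partial>M) = (\<integral>x. u x \<partial>(distr M M (t g)))"
    using t_mpt[OF assms(1)] by (simp add: mpt_def)
  also have "\<dots> = (\<integral>x. u (t g x) \<partial>M)"
    using assms by (intro integral_distr) auto
  finally show ?thesis by simp
qed

end

text \<open>
  The orbit hull of \<^term>\<open>B\<close> under \<^term>\<open>H\<close> consists of dyadic convex combinations of the
  indicators of translates of \<^term>\<open>B\<close>. Closure under midpoints, rather than under all convex
  combinations, is enough for the parallelogram law, and rule induction then has only one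
  step for translations and one for averages.
\<close>

inductive_set orbit_hull :: "('g \<Rightarrow> 'x \<Rightarrow> 'x) \<Rightarrow> 'g set \<Rightarrow> 'x set \<Rightarrow> ('x \<Rightarrow> real) set"
  for t H B where
  base: "indicator B \<in> orbit_hull t H B"
| translate: "u \<in> orbit_hull t H B \<Longrightarrow> k \<in> H \<Longrightarrow> (\<lambda>x. u (t k x)) \<in> orbit_hull t H B"
| midpoint: "u \<in> orbit_hull t H B \<Longrightarrow> v \<in> orbit_hull t H B \<Longrightarrow>
    (\<lambda>x. (u x + v x) / 2) \<in> orbit_hull t H B"

lemma orbit_hull_mono:
  assumes "u \<in> orbit_hull t H B" "H \<subseteq> H'"
  shows "u \<in> orbit_hull t H' B"
  using assms by (induction) (auto intro: orbit_hull.intros)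

text \<open>
  An element of the hull involves only finitely many translations, so it already lives over one
  of the groups of an increasing chain.
\<close>

lemma orbit_hull_Union:
  assumes "u \<in> orbit_hull t (\<Union>n. K n) B" and "\<And>n::nat. K n \<subseteq> K (Suc n)"
  shows "\<exists>N. \<forall>n\<ge>N. u \<in> orbit_hull t (K n) B"
proof -
  have mono: "K i \<subseteq> K j" if "i \<le> j" for i j
    using lift_Suc_mono_le[of K, OF assms(2) that] .
  have "\<exists>N. u \<in> orbit_hull t (K N) B"
    using assms(1)
  proof induction
    case base
    show ?case by (auto intro: orbit_hull.base)
  next
    case (translate u k)
    then obtain N i where "u \<in> orbit_hull t (K N) B" "k \<in> K i" by auto
    then have "u \<in> orbit_hull t (K (max N i)) B" "k \<in> K (max N i)"
      using mono[of N "max N i"] mono[of i "max N i"] by (auto intro: orbit_hull_mono)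
    then show ?case by (auto intro: orbit_hull.translate)
  next
    case (midpoint u v)
    then obtain N i where "u \<in> orbit_hull t (K N) B" "v \<in> orbit_hull t (K i) B" by auto
    then have "u \<in> orbit_hull t (K (max N i)) B" "v \<in> orbit_hull t (K (max N i)) B"
      using mono[of N "max N i"] mono[of i "max N i"] by (auto intro: orbit_hull_mono)
    then show ?case by (auto intro: orbit_hull.midpoint)
  qed
  then obtain N where "u \<in> orbit_hull t (K N) B" ..
  then show ?thesis using mono orbit_hull_mono by metis
qed

context near_action
begin

section \<open>A mean ergodic theorem\<close>

lemma orbit_hull_unit_interval:
  assumes "u \<in> orbit_hull t H B" "H \<subseteq> carrier G" "B \<in> sets M"
  shows "u \<in> borel_measurable M" "0 \<le> u x \<and> u x \<le> 1" "(\<integral>x. u x \<partial>M) = prob B"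
proof -
  have "u \<in> borel_measurable M \<and> (\<forall>x. 0 \<le> u x \<and> u x \<le> 1) \<and> (\<integral>x. u x \<partial>M) = prob B"
    using assms(1)
  proof induction
    case base
    show ?case using assms(3) sets.sets_into_space[OF assms(3)]
      by (auto simp: Int_absorb2)
  next
    case (translate u k)
    then have "k \<in> carrier G" using assms by auto
    with translate show ?case by (auto simp: integral_t)
  next
    case (midpoint u v)
    then have "integrable M u" "integrable M v"
      by (auto intro!: integrable_unit_interval)
    moreover have "u x + v x \<le> 2" for x
      using midpoint.IH add_mono[of "u x" 1 "v x" 1] by auto
    ultimately show ?case using midpoint by auto
  qed
  then show "u \<in> borel_measurable M" "0 \<le> u x \<and> u x \<le> 1" "(\<integral>x. u x \<partial>M) = prob B" by auto
qed

text \<open>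
  The parallelogram law: the midpoint of two almost minimizers of the $L^2$ norm still lies in the
  hull, so its norm is at least the infimum, which forces the difference to be small. The
  distance is stated in $L^1$ because only integrals of bounded functions matter afterwards.
\<close>

lemma almost_minimal_close:
  assumes H: "H \<subseteq> carrier G" and B: "B \<in> sets M"
    and min: "\<And>w. w \<in> orbit_hull t H B \<Longrightarrow> \<alpha> \<le> (\<integral>x. (w x)\<^sup>2 \<partial>M)"
    and u: "u \<in> orbit_hull t H B" "(\<integral>x. (u x)\<^sup>2 \<partial>M) \<le> \<alpha> + s\<^sup>2"
    and v: "v \<in> orbit_hull t H B" "(\<integral>x. (v x)\<^sup>2 \<partial>M) \<le> \<alpha> + s\<^sup>2"
    and s: "0 \<le> s"
  shows "(\<integral>x. \<bar>u x - v x\<bar> \<partial>M) \<le> 2 * s"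
proof (rule integral_abs_le_sqrt)
  note pu = orbit_hull_unit_interval[OF u(1) H B] and pv = orbit_hull_unit_interval[OF v(1) H B]
  note [measurable] = pu(1) pv(1)
  show "(\<lambda>x. u x - v x) \<in> borel_measurable M" by measurable
  show "\<bar>u x - v x\<bar> \<le> 1" for x using pu(2)[of x] pv(2)[of x] by auto
  define w where "w x = (u x + v x) / 2" for x
  have w: "w \<in> orbit_hull t H B" unfolding w_def using u v by (auto intro: orbit_hull.midpoint)
  note pw = orbit_hull_unit_interval[OF w H B]
  note [measurable] = pw(1)
  have i: "integrable M (\<lambda>x. (u x)\<^sup>2)" "integrable M (\<lambda>x. (v x)\<^sup>2)" "integrable M (\<lambda>x. (w x)\<^sup>2)"
    using pu(2) pv(2) pw(2) by (auto intro!: integrable_unit_interval simp: power_le_one)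
  have "(\<integral>x. (u x - v x)\<^sup>2 \<partial>M) = (\<integral>x. 2 * (u x)\<^sup>2 + 2 * (v x)\<^sup>2 - 4 * (w x)\<^sup>2 \<partial>M)"
    by (rule Bochner_Integration.integral_cong)
       (auto simp: w_def power2_eq_square field_simps)
  also have "\<dots> = 2 * (\<integral>x. (u x)\<^sup>2 \<partial>M) + 2 * (\<integral>x. (v x)\<^sup>2 \<partial>M) - 4 * (\<integral>x. (w x)\<^sup>2 \<partial>M)"
    using i by simp
  also have "\<dots> \<le> (2 * s)\<^sup>2" using u(2) v(2) min[OF w] by (simp add: power_mult_distrib)
  finally show "(\<integral>x. (u x - v x)\<^sup>2 \<partial>M) \<le> (2 * s)\<^sup>2" .
qed (use s in auto)

text \<open>
  The translates of \<^term>\<open>A\<close> depend continuously on the group element, so a translate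
  by \<^term>\<open>g\<close> is approximated by translates by elements of \<^term>\<open>H\<close>, all of which
  equal \<^term>\<open>A\<close> up to null sets.
\<close>

lemma invariant_of_invariant_on_dense:
  assumes dense: "\<tau> closure_of H = carrier G" and H: "H \<subseteq> carrier G"
    and A: "A \<in> sets M" and inv: "\<And>h. h \<in> H \<Longrightarrow> prob (sym_diff (pre h A) A) = 0"
    and g: "g \<in> carrier G"
  shows "prob (sym_diff (pre g A) A) = 0"
proof (rule ccontr)
  assume "prob (sym_diff (pre g A) A) \<noteq> 0"
  then have pos: "0 < prob (sym_diff (pre g A) A)" (is "0 < ?e")
    by (simp add: zero_less_measure_iff)
  define V where "V = {h \<in> carrier G. prob (sym_diff (pre h A) (pre g A)) < ?e}"
  have "openin \<tau> V"
    unfolding V_def by (rule t_cont[OF A g pos])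
  moreover have "g \<in> V"
    using g pos by (simp add: V_def)
  moreover have "g \<in> \<tau> closure_of H"
    using g dense by simp
  ultimately obtain h where h: "h \<in> H" "h \<in> V"
    by (auto simp: in_closure_of)
  then have hV: "prob (sym_diff (pre h A) (pre g A)) < ?e"
    by (simp add: V_def)
  have [measurable]: "pre g A \<in> sets M" "pre h A \<in> sets M" using A g h H by auto
  have "?e \<le> prob (sym_diff (pre h A) (pre g A) \<union> sym_diff (pre h A) A)"
    using A by (intro finite_measure_mono) auto
  also have "\<dots> \<le> prob (sym_diff (pre h A) (pre g A)) + prob (sym_diff (pre h A) A)"
    using A by (intro measure_Un_le) auto
  finally show False using hV h inv by simp
qed



text \<open>
  This is the mean ergodic theorem in the style of Alaoglu and Birkhoff, where an element of minimal
  norm replaces the averages along a sequence of sets. A minimizing sequence for the $L^2$ norm in the hull is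
  Cauchy; its translate by an element of \<^term>\<open>H\<close> is again minimizing, hence asymptotic to it, so
  the limit is invariant under \<^term>\<open>H\<close>, and its superlevel sets are invariant under the
  whole group by density. Ergodicity makes the limit constant, and the constant is
  \<^term>\<open>prob B\<close> because every element of the hull has this integral.
\<close>

lemma mean_ergodic_approximation:
  assumes dense: "\<tau> closure_of H = carrier G" and H: "H \<subseteq> carrier G"
    and B: "B \<in> sets M" and e: "0 < e"
    and ergodic: "\<And>A. A \<in> sets M \<Longrightarrow> (\<And>g. g \<in> carrier G \<Longrightarrow> prob (sym_diff (pre g A) A) = 0) \<Longrightarrow>
      prob A = 0 \<or> prob A = 1"
  shows "\<exists>u\<in>orbit_hull t H B. (\<integral>x. \<bar>u x - prob B\<bar> \<partial>M) < e"
proof -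
  define q where "q u = (\<integral>x. (u x)\<^sup>2 \<partial>M)" for u :: "'x \<Rightarrow> real"
  define \<alpha> where "\<alpha> = Inf (q ` orbit_hull t H B)"
  have ne: "q ` orbit_hull t H B \<noteq> {}"
    using orbit_hull.base by fast
  have min: "\<alpha> \<le> q w" if "w \<in> orbit_hull t H B" for w
    unfolding \<alpha>_def using that
    by (intro cInf_lower bdd_belowI[of _ 0]) (auto simp: q_def)
  have "\<exists>w\<in>orbit_hull t H B. q w < \<alpha> + ((1/2)^k)\<^sup>2" for k :: nat
    using cInf_lessD[OF ne, of "\<alpha> + ((1/2)^k)\<^sup>2"] by (auto simp: \<alpha>_def)
  then obtain w where w: "w k \<in> orbit_hull t H B" and qw: "q (w k) < \<alpha> + ((1/2)^k)\<^sup>2" for k :: nat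
    by metis
  have close: "(\<integral>x. \<bar>u x - v x\<bar> \<partial>M) \<le> 2 * s"
    if "u \<in> orbit_hull t H B" "v \<in> orbit_hull t H B" "q u \<le> \<alpha> + s\<^sup>2" "q v \<le> \<alpha> + s\<^sup>2" "0 \<le> s"
    for u v s
    using almost_minimal_close[OF H B, of \<alpha> u s v] min that unfolding q_def by blast
  note pw = orbit_hull_unit_interval[OF w H B]
  note [measurable] = pw(1)
  have iw: "integrable M (w k)" for k
    using pw(1,2) by (rule integrable_unit_interval)
  have q_mono: "q (w (Suc k)) \<le> \<alpha> + ((1/2)^k)\<^sup>2" for k
  proof -
    have "((1/2::real)^Suc k)\<^sup>2 \<le> ((1/2)^k)\<^sup>2"
      by (intro power_mono) auto
    then show ?thesis using qw[of "Suc k"] by linarith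
  qed
  have "AE x in M. convergent (\<lambda>k. w k x)"
  proof (rule AE_convergent_of_summable_L1[OF iw])
    show "(\<integral>x. \<bar>w (Suc k) x - w k x\<bar> \<partial>M) \<le> 2 * (1/2)^k" for k
      by (rule close) (use w qw[of k] q_mono[of k] in \<open>auto intro: less_imp_le\<close>)
    show "summable (\<lambda>k. 2 * (1/2::real)^k)"
      by (intro summable_mult summable_geometric) simp
  qed
  define f where "f x = lim (\<lambda>k. w k x)" for x
  have [measurable]: "f \<in> borel_measurable M"
    unfolding f_def by measurable
  have conv: "AE x in M. (\<lambda>k. w k x) \<longlonglongrightarrow> f x"
    using \<open>AE x in M. convergent (\<lambda>k. w k x)\<close>
    by eventually_elim (simp add: f_def convergent_LIMSEQ_iff)
  then have f01: "AE x in M. 0 \<le> f x \<and> f x \<le> 1"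
  proof eventually_elim
    case (elim x)
    show ?case
      using LIMSEQ_le_const[OF elim, of 0] LIMSEQ_le_const2[OF elim, of 1] pw(2) by auto
  qed
  have i_f: "integrable M f"
    by (rule integrable_const_bound[of _ 1]) (use f01 in auto)
  have lim: "(\<lambda>k. \<integral>x. \<bar>w k x - f x\<bar> \<partial>M) \<longlonglongrightarrow> 0"
  proof -
    have "(\<lambda>k. \<integral>x. \<bar>w k x - f x\<bar> \<partial>M) \<longlonglongrightarrow> (\<integral>x. 0 \<partial>M)"
    proof (rule integral_dominated_convergence[where w="\<lambda>_. 1"])
      show "AE x in M. (\<lambda>k. \<bar>w k x - f x\<bar>) \<longlonglongrightarrow> 0"
        using conv by eventually_elim (auto intro: tendsto_rabs_zero LIM_zero)
      show "AE x in M. norm \<bar>w k x - f x\<bar> \<le> 1" for k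
        using f01
      proof eventually_elim
        case (elim x)
        then show ?case using pw(2)[of k x] by auto
      qed
    qed auto
    then show ?thesis by simp
  qed
  have mean_f: "(\<integral>x. f x \<partial>M) = prob B"
  proof -
    have "\<bar>prob B - (\<integral>x. f x \<partial>M)\<bar> \<le> (\<integral>x. \<bar>w k x - f x\<bar> \<partial>M)" for k
    proof -
      have "prob B - (\<integral>x. f x \<partial>M) = (\<integral>x. w k x - f x \<partial>M)"
        using iw i_f pw(3)[of k] by simp
      then show ?thesis by (simp add: integral_abs_bound)
    qed
    then have "\<bar>prob B - (\<integral>x. f x \<partial>M)\<bar> \<le> 0"
      using lim by (intro LIMSEQ_le_const) auto
    then show ?thesis by simp
  qed
  have inv_f: "AE x in M. f (t h x) = f x" if h: "h \<in> H" for h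
  proof -
    have hG [measurable]: "h \<in> carrier G" using h H by auto
    have [measurable]: "t h \<in> measurable M M" using hG by (rule t_measurable)
    (* The three differences are f o t h to w k o t h, w k o t h to w k, and w k to f; the middle one
       compares two almost minimizers. *)
    have "(\<integral>x. \<bar>f (t h x) - f x\<bar> \<partial>M) \<le> 2 * (\<integral>x. \<bar>w k x - f x\<bar> \<partial>M) + 2 * (1/2)^k" for k
    proof -
      have w': "(\<lambda>x. w k (t h x)) \<in> orbit_hull t H B" using w h by (rule orbit_hull.translate)
      note pw' = orbit_hull_unit_interval[OF w' H B]
      have iw': "integrable M (\<lambda>x. w k (t h x))"
        using pw'(1,2) by (rule integrable_unit_interval)
      have if': "integrable M (\<lambda>x. f (t h x))"
      proof (rule integrable_const_bound[of _ 1])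
        show "AE x in M. norm (f (t h x)) \<le> 1"
          using mpt_AE[OF t_mpt[OF hG] f01] by auto
      qed measurable
      have "q (\<lambda>x. w k (t h x)) = q (w k)"
        unfolding q_def using hG by (intro integral_t) auto
      then have mid: "(\<integral>x. \<bar>w k (t h x) - w k x\<bar> \<partial>M) \<le> 2 * (1/2)^k"
        using w w' qw[of k] by (intro close) (auto intro: less_imp_le)
      have end1: "(\<integral>x. \<bar>w k (t h x) - f (t h x)\<bar> \<partial>M) = (\<integral>x. \<bar>w k x - f x\<bar> \<partial>M)"
        using integral_t[OF hG, of "\<lambda>x. \<bar>w k x - f x\<bar>"] by simp
      have "(\<integral>x. \<bar>f (t h x) - f x\<bar> \<partial>M) \<le>
          (\<integral>x. \<bar>w k (t h x) - f (t h x)\<bar> + \<bar>w k (t h x) - w k x\<bar> + \<bar>w k x - f x\<bar> \<partial>M)"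
        using iw[of k] iw' if' i_f by (intro integral_mono) auto
      also have "\<dots> = (\<integral>x. \<bar>w k (t h x) - f (t h x)\<bar> \<partial>M) + (\<integral>x. \<bar>w k (t h x) - w k x\<bar> \<partial>M)
          + (\<integral>x. \<bar>w k x - f x\<bar> \<partial>M)"
        using iw[of k] iw' if' i_f by simp
      finally show ?thesis using mid end1 by simp
    qed
    moreover have "(\<lambda>k. 2 * (\<integral>x. \<bar>w k x - f x\<bar> \<partial>M) + 2 * (1/2)^k) \<longlonglongrightarrow> 2 * 0 + 2 * 0"
      by (intro tendsto_add tendsto_mult lim tendsto_const LIMSEQ_power_zero) simp
    ultimately have "(\<integral>x. \<bar>f (t h x) - f x\<bar> \<partial>M) \<le> 0"
      by (intro LIMSEQ_le_const[where X="\<lambda>k. 2 * (\<integral>x. \<bar>w k x - f x\<bar> \<partial>M) + 2 * (1/2)^k"]) auto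
    moreover have "integrable M (\<lambda>x. \<bar>f (t h x) - f x\<bar>)"
    proof (rule integrable_const_bound[of _ 2])
      show "AE x in M. norm \<bar>f (t h x) - f x\<bar> \<le> 2"
        using mpt_AE[OF t_mpt[OF hG] f01] f01 by eventually_elim auto
    qed measurable
    moreover have "0 \<le> (\<integral>x. \<bar>f (t h x) - f x\<bar> \<partial>M)"
      by (rule integral_nonneg_AE) simp
    ultimately have "AE x in M. \<bar>f (t h x) - f x\<bar> = 0"
      using integral_nonneg_eq_0_iff_AE[of M "\<lambda>x. \<bar>f (t h x) - f x\<bar>"] by force
    then show ?thesis by eventually_elim simp
  qed
  (* A single level set suffices: whether it is null or conull, f - prob B has a constant sign
     almost everywhere, and its integral vanishes. *)
  define A where "A = {x \<in> space M. prob B < f x}"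
  have A [measurable]: "A \<in> sets M" unfolding A_def by measurable
  have "prob (sym_diff (pre g A) A) = 0" if "g \<in> carrier G" for g
  proof (rule invariant_of_invariant_on_dense[OF dense H A _ that])
    fix h assume h: "h \<in> H"
    then have hG: "h \<in> carrier G" using H by auto
    have "AE x in M. x \<notin> sym_diff (pre h A) A"
      using inv_f[OF h] AE_space
    proof eventually_elim
      case (elim x)
      then show ?case
        using measurable_space[OF t_measurable[OF hG], of x] by (auto simp: A_def)
    qed
    then show "prob (sym_diff (pre h A) A) = 0"
      using pre_sets[OF hG A] A by (subst prob_eq_0) auto
  qed
  then have "prob A = 0 \<or> prob A = 1" by (rule ergodic[OF A])
  then have "AE x in M. f x = prob B"
  proof
    assume "prob A = 0"
    then have "AE x in M. x \<notin> A" using A by (simp add: prob_eq_0)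
    then have le: "AE x in M. 0 \<le> prob B - f x"
      using AE_space by eventually_elim (auto simp: A_def)
    have "(\<integral>x. prob B - f x \<partial>M) = 0" using i_f mean_f by (simp add: prob_space)
    then have "AE x in M. prob B - f x = 0"
      using integral_nonneg_eq_0_iff_AE[OF _ le] i_f by simp
    then show ?thesis by eventually_elim simp
  next
    assume "prob A = 1"
    then have "AE x in M. x \<in> A" using A by (simp add: prob_eq_1)
    then have le: "AE x in M. 0 \<le> f x - prob B"
      by eventually_elim (auto simp: A_def)
    have "(\<integral>x. f x - prob B \<partial>M) = 0" using i_f mean_f by (simp add: prob_space)
    then have "AE x in M. f x - prob B = 0"
      using integral_nonneg_eq_0_iff_AE[OF _ le] i_f by simp
    then show ?thesis by eventually_elim simp
  qed
  then have "(\<integral>x. \<bar>w k x - f x\<bar> \<partial>M) = (\<integral>x. \<bar>w k x - prob B\<bar> \<partial>M)" for k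
    by (intro integral_cong_AE) auto
  moreover obtain k where "(\<integral>x. \<bar>w k x - f x\<bar> \<partial>M) < e"
    using order_tendstoD(2)[OF lim e] by (auto simp: eventually_sequentially)
  ultimately show ?thesis using w by auto
qed


section \<open>Haar averages of translates\<close>

lemma prob_Int_pre_diff:
  assumes "E \<in> sets M" "B \<in> sets M" "g \<in> carrier G" "h \<in> carrier G"
  shows "prob (E \<inter> pre g B) \<le> prob (E \<inter> pre h B) + prob (sym_diff (pre g B) (pre h B))"
proof -
  have [measurable]: "pre g B \<in> sets M" "pre h B \<in> sets M" using assms by auto
  have "prob (E \<inter> pre g B) \<le> prob ((E \<inter> pre h B) \<union> sym_diff (pre g B) (pre h B))"
    using assms(1) by (intro finite_measure_mono) auto
  also have "\<dots> \<le> prob (E \<inter> pre h B) + prob (sym_diff (pre g B) (pre h B))"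
    using assms(1) by (intro measure_Un_le) auto
  finally show ?thesis .
qed

lemma prob_Int_pre_measurable:
  assumes haar: "normalized_haar G \<tau> K m" and KG: "K \<subseteq> carrier G"
    and E: "E \<in> sets M" and B: "B \<in> sets M"
  shows "(\<lambda>g. prob (E \<inter> pre g B)) \<in> borel_measurable m"
proof (rule borel_measurable_iff_greater[THEN iffD2], intro allI)
  fix s :: real
  define W where "W = {g \<in> carrier G. s < prob (E \<inter> pre g B)}"
  have "openin \<tau> W"
  proof (subst openin_subopen, safe)
    fix g assume g: "g \<in> W"
    then have gG: "g \<in> carrier G" and pos: "0 < prob (E \<inter> pre g B) - s" by (auto simp: W_def)
    let ?V = "{h \<in> carrier G. prob (sym_diff (pre h B) (pre g B)) < prob (E \<inter> pre g B) - s}"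
    have "?V \<subseteq> W"
    proof safe
      fix h assume h: "h \<in> carrier G"
        and *: "prob (sym_diff (pre h B) (pre g B)) < prob (E \<inter> pre g B) - s"
      have "sym_diff (pre g B) (pre h B) = sym_diff (pre h B) (pre g B)" by blast
      then show "h \<in> W" using * h prob_Int_pre_diff[OF E B gG h] by (simp add: W_def)
    qed
    moreover have "openin \<tau> ?V" by (rule t_cont[OF B gG pos])
    moreover have "g \<in> ?V" using gG pos by simp
    ultimately show "\<exists>V. openin \<tau> V \<and> g \<in> V \<and> V \<subseteq> W" by blast
  qed
  then have "W \<inter> K \<in> sets m" by (rule haar_open_sets[OF haar])
  moreover have "{g \<in> space m. s < prob (E \<inter> pre g B)} = W \<inter> K"
    using KG by (auto simp: W_def normalized_haarD(2)[OF haar])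
  ultimately show "{g \<in> space m. s < prob (E \<inter> pre g B)} \<in> sets m" by simp
qed

text \<open>
  A Haar average absorbs translations: replacing the indicator of \<^term>\<open>B\<close> by
  a translate under an element \<^term>\<open>k\<close> of \<^term>\<open>K\<close> turns the integrand at \<^term>\<open>g\<close> into
  the integrand at \<^term>\<open>k \<otimes> g\<close>, and left invariance of the Haar measure removes \<^term>\<open>k\<close>. So the
  average is the same for all elements of the hull. Integrating against a fixed set
  \<^term>\<open>E\<close> keeps this a statement about scalar functions on \<^term>\<open>K\<close>, for which no joint
  measurability in the group element and the point is involved.
\<close>

lemma haar_average_orbit_hull:
  assumes haar: "normalized_haar G \<tau> K m" and K: "subgroup K G"
    and E: "E \<in> sets M" and B: "B \<in> sets M" and u: "u \<in> orbit_hull t K B"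
  shows "(\<lambda>g. \<integral>x. indicator E x * u (t g x) \<partial>M) \<in> borel_measurable m"
    and "(\<integral>g. (\<integral>x. indicator E x * u (t g x) \<partial>M) \<partial>m) = (\<integral>g. prob (E \<inter> pre g B) \<partial>m)"
proof -
  note sp = normalized_haarD(2)[OF haar]
  interpret m: prob_space m by (rule normalized_haarD(1)[OF haar])
  have KG: "K \<subseteq> carrier G" using K by (rule subgroup.subset)
  let ?P = "\<lambda>(u :: 'x \<Rightarrow> real) g. \<integral>x. indicator E x * u (t g x) \<partial>M"
  have transfer: "f \<in> borel_measurable m \<and> (\<integral>g. f g \<partial>m) = c"
    if "\<And>g. g \<in> K \<Longrightarrow> f g = h g" "h \<in> borel_measurable m" "(\<integral>g. h g \<partial>m) = c"
    for f h :: "'g \<Rightarrow> real" and c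
  proof
    show "f \<in> borel_measurable m"
      using that(1) by (subst measurable_cong[OF _ , of _ f h]) (auto simp: sp that(2))
    have "(\<integral>g. f g \<partial>m) = (\<integral>g. h g \<partial>m)"
      using that(1) by (intro Bochner_Integration.integral_cong) (auto simp: sp)
    then show "(\<integral>g. f g \<partial>m) = c" using that(3) by simp
  qed
  have "?P u \<in> borel_measurable m \<and> (\<integral>g. ?P u g \<partial>m) = (\<integral>g. prob (E \<inter> pre g B) \<partial>m)"
    using u
  proof induction
    case base
    have eq: "?P (indicator B) g = prob (E \<inter> pre g B)" if "g \<in> K" for g
    proof -
      have "?P (indicator B) g = (\<integral>x. indicator (E \<inter> pre g B) x \<partial>M)"
        by (intro Bochner_Integration.integral_cong) (auto simp: indicator_def)
      also have "\<dots> = prob (E \<inter> pre g B)"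
        using that KG E B sets.sets_into_space[OF E] by (auto simp: Int_absorb2 le_infI1)
      finally show ?thesis .
    qed
    show ?case
      using prob_Int_pre_measurable[OF haar KG E B] by (intro transfer[OF eq]) auto
  next
    case (translate u k)
    note pu = orbit_hull_unit_interval[OF translate(1) KG B]
    note [measurable] = pu(1) E
    have eq: "?P (\<lambda>x. u (t k x)) g = ?P u (k \<otimes> g)" if "g \<in> K" for g
    proof -
      have gk [measurable]: "g \<in> carrier G" "k \<in> carrier G" "k \<otimes> g \<in> carrier G"
        using that translate(2) KG by auto
      have [measurable]: "t g \<in> measurable M M" "t k \<in> measurable M M"
          "t (k \<otimes> g) \<in> measurable M M"
        using gk t_measurable by auto
      show ?thesis
      proof (rule integral_cong_AE)
        show "AE x in M. indicator E x * u (t k (t g x)) = indicator E x * u (t (k \<otimes> g) x)"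
          using t_mult[OF gk(2,1)] by eventually_elim simp
      qed measurable
    qed
    have "(\<lambda>g. ?P u (k \<otimes> g)) \<in> borel_measurable m"
      using measurable_compose[OF translation_measurable[OF haar K translate(2)]] translate.IH
      by blast
    then show ?case
      using haar_integral_translate[OF haar K translate(2), of "?P u"] translate.IH
      by (intro transfer[OF eq]) auto
  next
    case (midpoint u v)
    note pu = orbit_hull_unit_interval[OF midpoint(1) KG B]
    note pv = orbit_hull_unit_interval[OF midpoint(2) KG B]
    note [measurable] = pu(1) pv(1) E
    have i: "integrable M (\<lambda>x. indicator E x * w (t g x))"
      if "g \<in> K" "w \<in> borel_measurable M" "\<And>x. 0 \<le> w x \<and> w x \<le> 1" for g and w :: "'x \<Rightarrow> real"
    proof (rule integrable_const_bound[of _ 1])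
      have [measurable]: "t g \<in> measurable M M" "w \<in> borel_measurable M"
        using that KG t_measurable by auto
      show "(\<lambda>x. indicator E x * w (t g x)) \<in> borel_measurable M" by measurable
    qed (use that in \<open>auto simp: indicator_def\<close>)
    have bound: "norm (?P w g) \<le> 1"
      if "g \<in> K" "w \<in> borel_measurable M" "\<And>x. 0 \<le> w x \<and> w x \<le> 1" for g and w :: "'x \<Rightarrow> real"
    proof -
      have "?P w g \<le> (\<integral>x. 1 \<partial>M)"
        using i[OF that] that(3) by (intro integral_mono) (auto simp: indicator_def)
      moreover have "0 \<le> ?P w g"
        using that(3) by (intro integral_nonneg_AE) auto
      ultimately show ?thesis by (simp add: prob_space)
    qed
    have im: "integrable m (?P u)" "integrable m (?P v)"
      using midpoint.IH bound[OF _ pu(1,2)] bound[OF _ pv(1,2)]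
      by (auto intro!: m.integrable_const_bound[of _ 1] AE_I2 simp: sp)
    have eq: "?P (\<lambda>x. (u x + v x) / 2) g = (?P u g + ?P v g) / 2" if "g \<in> K" for g
    proof -
      have "?P (\<lambda>x. (u x + v x) / 2) g
          = (\<integral>x. (indicator E x * u (t g x) + indicator E x * v (t g x)) / 2 \<partial>M)"
        by (intro Bochner_Integration.integral_cong) (auto simp: field_simps)
      then show ?thesis using i[OF that pu(1,2)] i[OF that pv(1,2)] by simp
    qed
    have "(\<integral>g. (?P u g + ?P v g) / 2 \<partial>m) = (\<integral>g. prob (E \<inter> pre g B) \<partial>m)"
      using im midpoint.IH by simp
    moreover have "(\<lambda>g. (?P u g + ?P v g) / 2) \<in> borel_measurable m"
      using midpoint.IH
      by (intro borel_measurable_divide borel_measurable_add borel_measurable_const) auto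
    ultimately show ?case
      by (intro transfer[OF eq])
  qed
  then show "?P u \<in> borel_measurable m" "(\<integral>g. ?P u g \<partial>m) = (\<integral>g. prob (E \<inter> pre g B) \<partial>m)"
    by auto
qed

text \<open>
  Since the average may be computed with \<^term>\<open>u\<close> in place of the indicator of \<^term>\<open>B\<close>, it is
  as close to the product of the measures as \<^term>\<open>u\<close> is to its mean.
\<close>

lemma haar_average_lower_bound:
  assumes haar: "normalized_haar G \<tau> K m" and K: "subgroup K G"
    and E: "E \<in> sets M" and B: "B \<in> sets M" and u: "u \<in> orbit_hull t K B"
  shows "prob B * prob E - (\<integral>x. \<bar>u x - prob B\<bar> \<partial>M) \<le> (\<integral>g. prob (E \<inter> pre g B) \<partial>m)"
proof -
  note sp = normalized_haarD(2)[OF haar]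
  interpret m: prob_space m by (rule normalized_haarD(1)[OF haar])
  have KG: "K \<subseteq> carrier G" using K by (rule subgroup.subset)
  note pu = orbit_hull_unit_interval[OF u KG B]
  note [measurable] = pu(1) E
  let ?P = "\<lambda>g. \<integral>x. indicator E x * u (t g x) \<partial>M"
  have bd: "prob B * prob E - (\<integral>x. \<bar>u x - prob B\<bar> \<partial>M) \<le> ?P g \<and> \<bar>?P g\<bar> \<le> 1" if "g \<in> K" for g
  proof -
    have gG: "g \<in> carrier G" using that KG by auto
    then have [measurable]: "t g \<in> measurable M M" by (rule t_measurable)
    have iP: "integrable M (\<lambda>x. indicator E x * u (t g x))"
      by (rule integrable_const_bound[of _ 1]) (use pu(2) in \<open>auto simp: indicator_def\<close>)
    have ia: "integrable M (\<lambda>x. \<bar>u (t g x) - prob B\<bar>)"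
    proof (rule integrable_const_bound[of _ 1])
      show "AE x in M. norm \<bar>u (t g x) - prob B\<bar> \<le> 1"
      proof (rule AE_I2)
        fix x
        show "norm \<bar>u (t g x) - prob B\<bar> \<le> 1"
          using pu(2)[of "t g x"] prob_le_1[of B] measure_nonneg[of M B]
          by (simp only: real_norm_def abs_abs abs_le_iff) linarith
      qed
    qed measurable
    have iE: "integrable M (indicat_real E)"
      using E by (intro integrable_real_indicator) (auto simp: less_top[symmetric])
    have "prob B * prob E - (\<integral>x. \<bar>u x - prob B\<bar> \<partial>M)
        = (\<integral>x. prob B * indicator E x \<partial>M) - (\<integral>x. \<bar>u (t g x) - prob B\<bar> \<partial>M)"
      using integral_t[OF gG, of "\<lambda>x. \<bar>u x - prob B\<bar>"] E sets.sets_into_space[OF E]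
      by (simp add: Int_absorb2)
    also have "\<dots> = (\<integral>x. prob B * indicator E x - \<bar>u (t g x) - prob B\<bar> \<partial>M)"
      using ia iE by (intro Bochner_Integration.integral_diff[symmetric]) auto
    also have "\<dots> \<le> ?P g"
    proof (rule integral_mono)
      show "integrable M (\<lambda>x. prob B * indicator E x - \<bar>u (t g x) - prob B\<bar>)"
        using ia iE by (intro Bochner_Integration.integrable_diff) auto
    qed (use iP pu(2) in \<open>auto simp: indicator_def\<close>)
    finally have 1: "prob B * prob E - (\<integral>x. \<bar>u x - prob B\<bar> \<partial>M) \<le> ?P g" .
    have "?P g \<le> (\<integral>x. 1 \<partial>M)"
      using iP pu(2) by (intro integral_mono) (auto simp: indicator_def)
    moreover have "0 \<le> ?P g"
      using pu(2) by (intro integral_nonneg_AE) auto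
    ultimately show ?thesis using 1 by (simp add: prob_space)
  qed
  have "integrable m ?P"
    using haar_average_orbit_hull(1)[OF haar K E B u] bd
    by (auto intro!: m.integrable_const_bound[of _ 1] AE_I2 simp: sp)
  then have "prob B * prob E - (\<integral>x. \<bar>u x - prob B\<bar> \<partial>M) \<le> (\<integral>g. ?P g \<partial>m)"
    using bd by (intro m.integral_ge_const) (auto simp: sp intro!: AE_I2)
  then show ?thesis
    using haar_average_orbit_hull(2)[OF haar K E B u] by simp
qed



section \<open>Finite discretization and return sets\<close>

text \<open>
  The compact set \<^term>\<open>K\<close> is replaced by finitely many of its elements, close both in the metric and in
  their effect on \<^term>\<open>B\<close>. With only finitely many transformations involved, the exceptional null
  sets can be discarded together, and the set of group elements that move a given point
  into a given set becomes meaningful.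
\<close>

lemma finite_discretization:
  assumes haar: "normalized_haar G \<tau> K m" and K: "compactin \<tau> K" "K \<noteq> {}"
    and d: "compatible_metric \<tau> d" and B: "B \<in> sets M" and r: "0 < r" and \<delta>: "0 < \<delta>"
  shows "\<exists>\<sigma> \<in> measurable m (count_space UNIV). \<sigma> ` K \<subseteq> K \<and> finite (\<sigma> ` K) \<and>
    (\<forall>g\<in>K. d (\<sigma> g) g < r \<and> prob (sym_diff (pre g B) (pre (\<sigma> g) B)) < \<delta>)"
proof -
  note sp = normalized_haarD(2)[OF haar]
  have KG: "K \<subseteq> carrier G" using compactin_subset_topspace[OF K(1)] topspace_eq by simp
  interpret d: Metric_space "carrier G" d
    using d by (simp add: compatible_metric_def topspace_eq)
  have top: "d.mtopology = \<tau>"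
    using d by (simp add: compatible_metric_def topspace_eq)
  define V where "V c = d.mball c r \<inter>
    {h \<in> carrier G. prob (sym_diff (pre h B) (pre c B)) < \<delta>}" for c
  have V_open: "openin \<tau> (V c)" if "c \<in> K" for c
    unfolding V_def using that KG t_cont[OF B _ \<delta>] d.openin_mball[of c r]
    by (intro openin_Int) (auto simp: top)
  have V_self: "c \<in> V c" if "c \<in> K" for c
    using that KG r \<delta> by (auto simp: V_def)
  have "\<exists>\<F>. finite \<F> \<and> \<F> \<subseteq> V ` K \<and> K \<subseteq> \<Union>\<F>"
    using K(1) V_open V_self unfolding compactin_def by (auto dest!: spec[of _ "V ` K"])
  then obtain F where F: "finite F" "F \<subseteq> K" "K \<subseteq> (\<Union>c\<in>F. V c)"
    by (metis finite_subset_image)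
  have "F \<noteq> {}" using F(3) K(2) by auto
  define n where "n = card F"
  obtain c where c: "bij_betw c {..<n} F"
    using ex_bij_betw_nat_finite[OF F(1)] by (auto simp: n_def atLeast0LessThan)
  (* Choosing the first of the finitely many neighbourhoods that contains g makes the choice
     measurable. *)
  define I where "I g = (LEAST i. i < n \<and> g \<in> V (c i))" for g
  have cF: "c i \<in> K" if "i < n" for i using bij_betw_apply[OF c, of i] that F(2) by blast
  have I: "I g < n \<and> g \<in> V (c (I g))" if "g \<in> K" for g
  proof -
    obtain x where "x \<in> F" "g \<in> V x" using F(3) \<open>g \<in> K\<close> by blast
    moreover from this obtain i where "i < n" "x = c i"
      using bij_betw_imp_surj_on[OF c] by blast
    ultimately have "i < n \<and> g \<in> V (c i)" by simp
    then show ?thesis unfolding I_def by (rule LeastI)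
  qed
  have "Measurable.pred m (\<lambda>g. i < n \<and> g \<in> V (c i))" for i
  proof (cases "i < n")
    case True
    then have "V (c i) \<inter> K \<in> sets m" using haar_open_sets[OF haar V_open[OF cF]] by auto
    moreover have "{g \<in> space m. i < n \<and> g \<in> V (c i)} = V (c i) \<inter> K" using True sp by auto
    ultimately show ?thesis by (simp add: pred_def)
  qed simp
  then have [measurable]: "I \<in> measurable m (count_space UNIV)"
    unfolding I_def by (rule measurable_Least)
  define \<sigma> where "\<sigma> g = c (I g)" for g
  show ?thesis
  proof (intro bexI[of _ \<sigma>] conjI ballI)
    show "\<sigma> \<in> measurable m (count_space UNIV)" unfolding \<sigma>_def by measurable
    show sub: "\<sigma> ` K \<subseteq> K" using I cF by (auto simp: \<sigma>_def)
    have "\<sigma> ` K \<subseteq> c ` {..<n}" using I by (auto simp: \<sigma>_def)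
    then show "finite (\<sigma> ` K)" by (rule finite_subset) simp
    fix g assume g: "g \<in> K"
    then have "g \<in> V (\<sigma> g)" using I by (simp add: \<sigma>_def)
    then show "d (\<sigma> g) g < r" "prob (sym_diff (pre g B) (pre (\<sigma> g) B)) < \<delta>"
      by (auto simp: V_def)
  qed
qed

text \<open>
  Fubini's theorem for the occupation function \<^term>\<open>f\<close>. Because \<^term>\<open>\<sigma>\<close> takes finitely many
  values, \<^term>\<open>f\<close> is a finite linear combination of indicators and no product measure is needed.
\<close>

lemma discretized_occupation:
  assumes m: "prob_space m" and \<sigma>: "\<sigma> \<in> measurable m (count_space UNIV)"
    and fin: "finite (\<sigma> ` space m)" and sub: "\<sigma> ` space m \<subseteq> carrier G"
    and D: "D \<in> sets M"
  defines "f \<equiv> \<lambda>x. measure m {g \<in> space m. t (\<sigma> g) x \<in> D}"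
  shows "f \<in> borel_measurable M"
    and "E \<in> sets M \<Longrightarrow> (\<integral>x. indicator E x * f x \<partial>M) = (\<integral>g. prob (E \<inter> pre (\<sigma> g) D) \<partial>m)"
proof -
  interpret m: prob_space m by (rule m)
  let ?p = "\<lambda>c. measure m (\<sigma> -` {c} \<inter> space m)"
  have f: "f x = (\<Sum>c\<in>\<sigma> ` space m. ?p c * indicator (pre c D) x)" if x: "x \<in> space M" for x
  proof -
    have "{g \<in> space m. t (\<sigma> g) x \<in> D} = \<sigma> -` {c. t c x \<in> D} \<inter> space m" by auto
    moreover have "\<sigma> -` {c. t c x \<in> D} \<inter> space m \<in> sets m"
      using \<sigma> by (rule measurable_sets) simp
    ultimately have "{g \<in> space m. t (\<sigma> g) x \<in> D} \<in> sets m" by (simp only:)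
    then have "f x = (\<integral>g. indicator {g \<in> space m. t (\<sigma> g) x \<in> D} g \<partial>m)"
      by (simp add: f_def Int_absorb2)
    also have "\<dots> = (\<integral>g. (\<lambda>c. indicator (pre c D) x) (\<sigma> g) \<partial>m)"
      using x by (intro Bochner_Integration.integral_cong) (auto simp: indicator_def)
    also have "\<dots> = (\<Sum>c\<in>\<sigma> ` space m. ?p c * indicator (pre c D) x)"
      by (rule integral_finite_image[OF m \<sigma> fin])
    finally show ?thesis .
  qed
  have s [measurable]: "pre c D \<in> sets M" if "c \<in> \<sigma> ` space m" for c
    using that sub D by auto
  have "(\<lambda>x. \<Sum>c\<in>\<sigma> ` space m. ?p c * indicator (pre c D) x) \<in> borel_measurable M"
    using s by (intro borel_measurable_sum borel_measurable_times) auto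
  then show "f \<in> borel_measurable M"
    using f by (simp cong: measurable_cong)
  show "(\<integral>x. indicator E x * f x \<partial>M) = (\<integral>g. prob (E \<inter> pre (\<sigma> g) D) \<partial>m)"
    if E: "E \<in> sets M"
  proof -
    have "(\<integral>x. indicator E x * f x \<partial>M)
        = (\<integral>x. (\<Sum>c\<in>\<sigma> ` space m. ?p c * indicator (E \<inter> pre c D) x) \<partial>M)"
      using f by (intro Bochner_Integration.integral_cong)
        (auto simp: sum_distrib_left indicator_def intro!: sum.cong)
    also have "\<dots> = (\<Sum>c\<in>\<sigma> ` space m. ?p c * prob (E \<inter> pre c D))"
    proof -
      have "integrable M (indicat_real (E \<inter> pre c D))" if "c \<in> \<sigma> ` space m" for c
        using s[OF that] E by (intro integrable_real_indicator) (auto simp: less_top[symmetric])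
      then show ?thesis
        using sets.sets_into_space[OF E]
        by (subst Bochner_Integration.integral_sum)
           (auto simp: Int_absorb2 le_infI1 intro!: sum.cong)
    qed
    also have "\<dots> = (\<integral>g. prob (E \<inter> pre (\<sigma> g) D) \<partial>m)"
      using integral_finite_image[OF m \<sigma> fin, of "\<lambda>c. prob (E \<inter> pre c D)"] by simp
    finally show ?thesis .
  qed
qed

text \<open>
  For a point \<^term>\<open>x\<close>, consider the elements of \<^term>\<open>K\<close> whose discretization moves \<^term>\<open>x\<close>
  into \<^term>\<open>B\<close>, respectively into \<^term>\<open>A\<close>. Almost surely they are at a definite distance,
  because of two nearby group elements, one cannot move \<^term>\<open>x\<close> into \<^term>\<open>B\<close> and the other
  into \<^term>\<open>A\<close>. For most
  points \<^term>\<open>x\<close> the first set is large: its Haar measure is nearly constant in \<^term>\<open>x\<close> by the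
  mean ergodic approximation. The second set is large for some of these points, since its
  average Haar measure is \<^term>\<open>prob A\<close>. The error \<^term>\<open>prob A * prob B / 8\<close> is spent twice,
  once on the ergodic approximation and once on the discretization; this bounds the measure of
  the points with a small first set by \<^term>\<open>prob A / 2\<close>, and \<^term>\<open>prob A / 2 + prob A / 4\<close>
  is still less than \<^term>\<open>prob A\<close>.
\<close>

lemma separated_return_sets:
  assumes haar: "normalized_haar G \<tau> K m" and K: "subgroup K G" "compactin \<tau> K"
    and d: "compatible_metric \<tau> d"
    and A: "A \<in> sets M" "0 < prob A" and B: "B \<in> sets M" "0 < prob B"
    and u: "u \<in> orbit_hull t K B" "(\<integral>x. \<bar>u x - prob B\<bar> \<partial>M) < prob A * prob B / 8"
    and r: "0 < r"
    and null: "\<And>g h. g \<in> K \<Longrightarrow> h \<in> K \<Longrightarrow> d g h < 3 * r \<Longrightarrow> prob (pre h A \<inter> pre g B) = 0"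
  shows "\<exists>S\<in>sets m. \<exists>R\<in>sets m. prob B / 2 \<le> measure m S \<and> prob A / 4 \<le> measure m R \<and>
    (\<forall>g\<in>S. \<forall>h\<in>R. r \<le> d g h)"
proof -
  note sp = normalized_haarD(2)[OF haar]
  note m = normalized_haarD(1)[OF haar]
  interpret m: prob_space m by (rule m)
  have KG: "K \<subseteq> carrier G" using K(1) by (rule subgroup.subset)
  interpret d: Metric_space "carrier G" d
    using d by (simp add: compatible_metric_def topspace_eq)
  define \<delta> where "\<delta> = prob A * prob B / 8"
  have \<delta>: "0 < \<delta>" using A B by (simp add: \<delta>_def)
  have "K \<noteq> {}" using subgroup.one_closed[OF K(1)] by auto
  from finite_discretization[OF haar K(2) this d B(1) r \<delta>]
  obtain \<sigma> where \<sigma>: "\<sigma> \<in> measurable m (count_space UNIV)" "\<sigma> ` K \<subseteq> K" "finite (\<sigma> ` K)"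
    and \<sigma>d: "\<And>g. g \<in> K \<Longrightarrow> d (\<sigma> g) g < r"
    and \<sigma>p: "\<And>g. g \<in> K \<Longrightarrow> prob (sym_diff (pre g B) (pre (\<sigma> g) B)) < \<delta>"
    by auto
  define S where "S x = {g \<in> K. t (\<sigma> g) x \<in> B}" for x
  define R where "R x = {g \<in> K. t (\<sigma> g) x \<in> A}" for x
  have S_sets: "S x \<in> sets m" for x
  proof -
    have "S x = \<sigma> -` {c. t c x \<in> B} \<inter> space m" by (auto simp: S_def sp)
    moreover have "\<sigma> -` {c. t c x \<in> B} \<inter> space m \<in> sets m"
      using \<sigma>(1) by (rule measurable_sets) simp
    ultimately show ?thesis by (simp only:)
  qed
  have R_sets: "R x \<in> sets m" for x
  proof -
    have "R x = \<sigma> -` {c. t c x \<in> A} \<inter> space m" by (auto simp: R_def sp)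
    moreover have "\<sigma> -` {c. t c x \<in> A} \<inter> space m \<in> sets m"
      using \<sigma>(1) by (rule measurable_sets) simp
    ultimately show ?thesis by (simp only:)
  qed
  have \<sigma>': "finite (\<sigma> ` space m)" "\<sigma> ` space m \<subseteq> carrier G" using \<sigma> KG sp by auto
  note occB = discretized_occupation[OF m \<sigma>(1) \<sigma>' B(1), unfolded sp, folded S_def]
  note occA = discretized_occupation[OF m \<sigma>(1) \<sigma>' A(1), unfolded sp, folded R_def]
  note [measurable] = occB(1) occA(1)
  (* The points at which the average over K falls far below its mean. *)
  define E where "E = {x \<in> space M. measure m (S x) < prob B / 2}"
  have E [measurable]: "E \<in> sets M" unfolding E_def by measurable
  have iE: "integrable M (indicat_real E)"
      using E by (intro integrable_real_indicator) (auto simp: less_top[symmetric])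
  have E_small: "prob E \<le> prob A / 2"
  proof -
    have "prob B * prob E - \<delta> \<le> (\<integral>g. prob (E \<inter> pre g B) \<partial>m)"
      using haar_average_lower_bound[OF haar K(1) E B(1) u(1)] u(2) by (simp add: \<delta>_def)
    also have "\<dots> \<le> (\<integral>g. prob (E \<inter> pre (\<sigma> g) B) + \<delta> \<partial>m)"
    proof (rule integral_mono)
      show i1: "integrable m (\<lambda>g. prob (E \<inter> pre g B))"
        by (rule m.integrable_const_bound[of _ 1])
           (auto intro: prob_Int_pre_measurable[OF haar KG E B(1)])
      have "(\<lambda>g. prob (E \<inter> pre (\<sigma> g) B)) \<in> borel_measurable m"
        using measurable_compose[OF \<sigma>(1), of "\<lambda>c. prob (E \<inter> pre c B)" borel] by simp
      then have "integrable m (\<lambda>g. prob (E \<inter> pre (\<sigma> g) B))"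
        by (intro m.integrable_const_bound[of _ 1]) auto
      then show "integrable m (\<lambda>g. prob (E \<inter> pre (\<sigma> g) B) + \<delta>)" by simp
      fix g assume "g \<in> space m"
      then have g: "g \<in> K" "g \<in> carrier G" "\<sigma> g \<in> carrier G" using sp KG \<sigma>(2) by auto
      show "prob (E \<inter> pre g B) \<le> prob (E \<inter> pre (\<sigma> g) B) + \<delta>"
        using prob_Int_pre_diff[OF E B(1) g(2,3)] \<sigma>p[OF g(1)] by simp
    qed
    also have "\<dots> = (\<integral>x. indicator E x * measure m (S x) \<partial>M) + \<delta>"
    proof -
      have "(\<lambda>g. prob (E \<inter> pre (\<sigma> g) B)) \<in> borel_measurable m"
        using measurable_compose[OF \<sigma>(1), of "\<lambda>c. prob (E \<inter> pre c B)" borel] by simp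
      then have "integrable m (\<lambda>g. prob (E \<inter> pre (\<sigma> g) B))"
        by (intro m.integrable_const_bound[of _ 1]) auto
      then show ?thesis using occB(2)[OF E] by (simp add: m.prob_space)
    qed
    also have "(\<integral>x. indicator E x * measure m (S x) \<partial>M) \<le> (\<integral>x. prob B / 2 * indicator E x \<partial>M)"
    proof (rule integral_mono)
      show "integrable M (\<lambda>x. indicator E x * measure m (S x))"
        by (rule integrable_const_bound[of _ 1]) (auto simp: indicator_def)
      show "integrable M (\<lambda>x. prob B / 2 * indicator E x)" using iE by simp
    qed (auto simp: indicator_def E_def)
    also have "\<dots> = prob B / 2 * prob E"
      using sets.sets_into_space[OF E] by (simp add: Int_absorb2)
    finally have "prob B * (prob E * 4) \<le> prob B * (prob A * 2)"
      by (simp add: \<delta>_def field_simps)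
    then show ?thesis using B(2) by simp
  qed
  define N where "N = (\<Union>g\<in>\<sigma> ` K. \<Union>h\<in>{h\<in>\<sigma> ` K. d g h < 3 * r}. pre h A \<inter> pre g B)"
  have N: "N \<in> null_sets M"
    unfolding N_def
  proof (intro null_sets_UN' countable_finite)
    fix g h assume "g \<in> \<sigma> ` K" "h \<in> {h \<in> \<sigma> ` K. d g h < 3 * r}"
    then have gh: "g \<in> K" "h \<in> K" "d g h < 3 * r" using \<sigma>(2) by auto
    moreover from this have "pre h A \<inter> pre g B \<in> sets M" using KG A B
      by (intro sets.Int pre_sets) auto
    ultimately show "pre h A \<inter> pre g B \<in> null_sets M"
      using null[OF gh] by (auto simp: emeasure_eq_measure)
  qed (use \<sigma>(3) in auto)
  have "\<exists>x\<in>space M. x \<notin> N \<and> x \<notin> E \<and> prob A / 4 \<le> measure m (R x)"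
  proof (rule ccontr)
    assume neg: "\<not> ?thesis"
    have "prob A = (\<integral>g. prob (space M \<inter> pre (\<sigma> g) A) \<partial>m)"
    proof -
      have "prob (space M \<inter> pre (\<sigma> g) A) = prob A" if "g \<in> space m" for g
        using that prob_pre[of "\<sigma> g" A] A \<sigma>' by (auto simp: Int_absorb1)
      then have "(\<integral>g. prob (space M \<inter> pre (\<sigma> g) A) \<partial>m) = (\<integral>g. prob A \<partial>m)"
        by (intro Bochner_Integration.integral_cong) auto
      then show ?thesis by (simp add: m.prob_space)
    qed
    also have "\<dots> = (\<integral>x. indicator (space M) x * measure m (R x) \<partial>M)"
      by (rule occA(2)[symmetric]) simp
    also have "\<dots> \<le> (\<integral>x. prob A / 4 + indicator E x \<partial>M)"
    proof (rule integral_mono_AE)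
      show "integrable M (\<lambda>x. indicator (space M) x * measure m (R x))"
        by (rule integrable_const_bound[of _ 1]) (auto simp: indicator_def)
      show "integrable M (\<lambda>x. prob A / 4 + indicator E x)" using iE by simp
      show "AE x in M. indicator (space M) x * measure m (R x) \<le> prob A / 4 + indicator E x"
        using AE_not_in[OF N] AE_space
      proof eventually_elim
        case (elim x)
        show ?case
        proof (cases "x \<in> E")
          case True
          then show ?thesis using m.prob_le_1[of "R x"] measure_nonneg[of M A] elim
            by (simp add: add_increasing)
        next
          case False
          then have "measure m (R x) < prob A / 4" using neg elim by force
          then show ?thesis using elim False by simp
        qed
      qed
    qed
    also have "\<dots> = prob A / 4 + prob E"
      using iE sets.sets_into_space[OF E] by (simp add: Int_absorb2 prob_space)
    finally show False using E_small A(2) by linarith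
  qed
  then obtain x where x: "x \<in> space M" "x \<notin> N" "x \<notin> E" "prob A / 4 \<le> measure m (R x)"
    by (elim bexE conjE)
  show ?thesis
  proof (rule bexI[OF _ S_sets[of x]], rule bexI[OF _ R_sets[of x]], intro conjI ballI)
    show "prob B / 2 \<le> measure m (S x)" using x(1,3) by (simp add: E_def not_less)
    show "prob A / 4 \<le> measure m (R x)" by (rule x(4))
    fix g h assume g: "g \<in> S x" and h: "h \<in> R x"
    then have gh: "g \<in> K" "h \<in> K" by (auto simp: S_def R_def)
    then have G: "g \<in> carrier G" "h \<in> carrier G" "\<sigma> g \<in> carrier G" "\<sigma> h \<in> carrier G"
      using KG \<sigma>(2) by auto
    show "r \<le> d g h"
    proof (rule ccontr)
      assume "\<not> r \<le> d g h"
      then have "d (\<sigma> g) (\<sigma> h) < 3 * r"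
        using \<sigma>d[OF gh(1)] \<sigma>d[OF gh(2)] d.triangle[OF G(3) G(1) G(4)] d.triangle[OF G(1,2,4)]
          d.commute[of h "\<sigma> h"] by linarith
      moreover have "x \<in> pre (\<sigma> h) A \<inter> pre (\<sigma> g) B"
        using g h x(1) by (auto simp: S_def R_def)
      ultimately have "x \<in> N"
        unfolding N_def using gh by (intro UN_I[of "\<sigma> g"] UN_I[of "\<sigma> h"]) auto
      then show False using x(2) by simp
    qed
  qed
qed



section \<open>Concentration of measure forces whirling\<close>

text \<open>
  Translating by \<^term>\<open>g\<close> reduces the pair of elements to their quotient. The quotient is formed on
  the right, which is why a right-invariant metric controls its distance to the identity.
\<close>

lemma null_of_near_identity:
  assumes A: "A \<in> sets M" and B: "B \<in> sets M" and g: "g \<in> carrier G" and h: "h \<in> carrier G"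
    and null: "prob (pre (h \<otimes> inv g) A \<inter> B) = 0"
  shows "prob (pre h A \<inter> pre g B) = 0"
proof -
  have v: "h \<otimes> inv g \<in> carrier G" using g h by simp
  have s [measurable]: "pre h A \<in> sets M" "pre g B \<in> sets M" "pre (h \<otimes> inv g) A \<in> sets M"
    using A B g h v by auto
  have "h \<otimes> inv g \<otimes> g = h" using g h by (simp add: G.m_assoc)
  then have "AE x in M. t h x = t (h \<otimes> inv g) (t g x)"
    using t_mult[OF v g] by simp
  then have "AE x in M. x \<in> pre h A \<inter> pre g B \<longleftrightarrow> x \<in> pre g (pre (h \<otimes> inv g) A \<inter> B)"
    using AE_space
    by eventually_elim (use measurable_space[OF t_measurable[OF g]] in auto)
  moreover have "pre (h \<otimes> inv g) A \<inter> B \<in> sets M"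
    using s(3) B by (rule sets.Int)
  then have "pre g (pre (h \<otimes> inv g) A \<inter> B) \<in> sets M"
    by (rule pre_sets[OF g])
  ultimately have "prob (pre h A \<inter> pre g B) = prob (pre g (pre (h \<otimes> inv g) A \<inter> B))"
    using sets.Int[OF s(1,2)] by (intro finite_measure_eq_AE)
  also have "\<dots> = 0" using prob_pre[OF g, of "pre (h \<otimes> inv g) A \<inter> B"] s B null by simp
  finally show ?thesis .
qed

text \<open>
  If no element of a ball around the identity moves \<^term>\<open>B\<close> into \<^term>\<open>A\<close>, then all sufficiently
  large groups in the chain contain two sets of Haar measure bounded below and at a fixed distance
  from each other, which contradicts concentration of measure.
\<close>

lemma levy_imp_whirly:
  assumes levy: "levy_group G \<tau>"
    and ergodic: "\<And>A. A \<in> sets M \<Longrightarrow> (\<And>g. g \<in> carrier G \<Longrightarrow> prob (sym_diff (pre g A) A) = 0) \<Longrightarrow>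
      prob A = 0 \<or> prob A = 1"
    and A: "A \<in> sets M" "0 < prob A" and B: "B \<in> sets M" "0 < prob B"
    and U: "openin \<tau> U" "\<one> \<in> U"
  shows "\<exists>g\<in>U. 0 < prob (pre g A \<inter> B)"
proof (rule ccontr)
  assume neg: "\<not> ?thesis"
  obtain K m d where K': "\<forall>n. subgroup (K n) G \<and> compactin \<tau> (K n) \<and> K n \<subseteq> K (Suc n)"
    and dense: "\<tau> closure_of (\<Union>n. K n) = carrier G"
    and haar': "\<forall>n. normalized_haar G \<tau> (K n) (m n)"
    and d: "compatible_metric \<tau> d" "right_invariant G d"
    and fam: "levy_family K (\<lambda>n. d) m"
    using levy unfolding levy_group_def by (elim exE conjE)
  have K: "subgroup (K n) G" "compactin \<tau> (K n)" "K n \<subseteq> K (Suc n)" for n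
    using K' by auto
  have haar: "normalized_haar G \<tau> (K n) (m n)" for n
    using haar' by auto
  have KG: "K n \<subseteq> carrier G" for n using K(1) by (rule subgroup.subset)
  interpret d: Metric_space "carrier G" d
    using d by (simp add: compatible_metric_def topspace_eq)
  have top: "d.mtopology = \<tau>"
    using d by (simp add: compatible_metric_def topspace_eq)
  obtain \<epsilon> where \<epsilon>: "0 < \<epsilon>" "d.mball \<one> \<epsilon> \<subseteq> U"
    using U unfolding top[symmetric] d.openin_mtopology by blast
  define r where "r = \<epsilon> / 3"
  have r: "0 < r" "3 * r = \<epsilon>" using \<epsilon> by (auto simp: r_def)
  have null: "prob (pre h A \<inter> pre g B) = 0"
    if "g \<in> carrier G" "h \<in> carrier G" "d g h < 3 * r" for g h
  proof (rule null_of_near_identity[OF A(1) B(1) that(1,2)])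
    have v: "h \<otimes> inv g \<in> carrier G" using that by simp
    have "d (g \<otimes> inv g) (h \<otimes> inv g) = d g h"
      using d(2) that G.inv_closed[OF that(1)] unfolding right_invariant_def by blast
    then have "h \<otimes> inv g \<in> d.mball \<one> \<epsilon>"
      using that v r by (simp add: d.in_mball)
    then have "h \<otimes> inv g \<in> U" using \<epsilon> by blast
    then show "prob (pre (h \<otimes> inv g) A \<inter> B) = 0"
      using neg by (auto simp: not_less measure_le_0_iff)
  qed
  have "\<exists>u\<in>orbit_hull t (\<Union>n. K n) B. (\<integral>x. \<bar>u x - prob B\<bar> \<partial>M) < prob A * prob B / 8"
  proof (rule mean_ergodic_approximation[OF dense _ B(1)])
    show "(\<Union>n. K n) \<subseteq> carrier G" using KG by blast
    show "0 < prob A * prob B / 8" using A B by simp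
  qed (rule ergodic)
  then obtain u where u: "u \<in> orbit_hull t (\<Union>n. K n) B"
      "(\<integral>x. \<bar>u x - prob B\<bar> \<partial>M) < prob A * prob B / 8"
    by (elim bexE)
  obtain N where N: "\<And>n. n \<ge> N \<Longrightarrow> u \<in> orbit_hull t (K n) B"
    using orbit_hull_Union[OF u(1) K(3)] by auto
  have "\<exists>S R. n \<ge> N \<longrightarrow> S \<in> sets (m n) \<and> R \<in> sets (m n) \<and>
      prob B / 2 \<le> measure (m n) S \<and> prob A / 4 \<le> measure (m n) R \<and>
      (\<forall>g\<in>S. \<forall>h\<in>R. r \<le> d g h)" for n
  proof (cases "n \<ge> N")
    case True
    have "\<exists>S\<in>sets (m n). \<exists>R\<in>sets (m n). prob B / 2 \<le> measure (m n) S \<and>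
        prob A / 4 \<le> measure (m n) R \<and> (\<forall>g\<in>S. \<forall>h\<in>R. r \<le> d g h)"
      using null KG[of n]
      by (intro separated_return_sets[OF haar K(1,2) d(1) A B N[OF True] u(2) r(1)]) auto
    then show ?thesis by auto
  qed simp
  then obtain S R where SR: "\<And>n. n \<ge> N \<Longrightarrow> S n \<in> sets (m n) \<and> R n \<in> sets (m n) \<and>
      prob B / 2 \<le> measure (m n) (S n) \<and> prob A / 4 \<le> measure (m n) (R n) \<and>
      (\<forall>g\<in>S n. \<forall>h\<in>R n. r \<le> d g h)"
    by metis
  (* The family has to be defined for all n, but finitely many of its members do not affect the
     lower limit. *)
  define S' where "S' n = (if n \<ge> N then S n else {})" for n
  have fm: "finite_measure (m n)" for n
    using normalized_haarD(1)[OF haar] by (rule prob_space.finite_measure)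
  have "eventually (\<lambda>n. ennreal (prob B / 2) \<le> emeasure (m n) (S' n)) sequentially"
    unfolding eventually_sequentially
  proof (intro exI[of _ N] allI impI)
    fix n assume n: "N \<le> n"
    have "ennreal (prob B / 2) \<le> ennreal (measure (m n) (S n))"
      using SR[OF n] by (intro ennreal_leI) simp
    also have "\<dots> = emeasure (m n) (S' n)"
      using n finite_measure.emeasure_eq_measure[OF fm[of n], of "S n"] by (simp add: S'_def)
    finally show "ennreal (prob B / 2) \<le> emeasure (m n) (S' n)" .
  qed
  then have "ennreal (prob B / 2) \<le> liminf (\<lambda>n. emeasure (m n) (S' n))"
    by (rule Liminf_bounded[where C = "ennreal (prob B / 2)" and X = "\<lambda>n. emeasure (m n) (S' n)"])
  moreover have "0 < ennreal (prob B / 2)" using B(2) by simp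
  ultimately have "0 < liminf (\<lambda>n. emeasure (m n) (S' n))" by (rule less_le_trans[rotated])
  moreover have "S' n \<in> sets (m n)" for n using SR by (auto simp: S'_def)
  ultimately have lim: "(\<lambda>n. measure (m n) (metric_nhd (K n) d r (S' n))) \<longlonglongrightarrow> 1"
    using conjunct2[OF fam[unfolded levy_family_def], THEN spec, of S'] r(1) by blast
  have "measure (m n) (metric_nhd (K n) d r (S' n)) \<le> 1 - prob A / 4" if n: "n \<ge> N" for n
  proof -
    interpret m: prob_space "m n" by (rule normalized_haarD(1)[OF haar])
    interpret Kn: Metric_space "K n" d
      using d.subspace[OF KG] .
    have sp: "space (m n) = K n" by (rule normalized_haarD(2)[OF haar])
    have RK: "R n \<in> sets (m n)" using SR[OF n] by (elim conjE)
    have "metric_nhd (K n) d r (S' n) \<subseteq> space (m n) - R n"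
    proof
      fix h assume "h \<in> metric_nhd (K n) d r (S' n)"
      then obtain g where "g \<in> S n" "h \<in> K n" "d g h < r"
        using n by (auto simp: metric_nhd_def S'_def Kn.in_mball)
      then show "h \<in> space (m n) - R n"
        using SR[OF n] by (auto simp: sp not_less[symmetric])
    qed
    then have "measure (m n) (metric_nhd (K n) d r (S' n)) \<le> measure (m n) (space (m n) - R n)"
      using RK by (intro m.finite_measure_mono) auto
    also have "\<dots> \<le> 1 - prob A / 4"
      using SR[OF n] RK by (simp add: m.prob_compl)
    finally show ?thesis .
  qed
  then have "1 \<le> 1 - prob A / 4"
    by (intro LIMSEQ_le_const2[OF lim]) auto
  then show False using A(2) by simp
qed

end

text \<open>
  Any choice of representatives works. For the continuity, a subbasic neighbourhood of
  \<^term>\<open>\<phi> g\<close> compares a set \<^term>\<open>C\<close> with its image under \<^term>\<open>\<phi> g\<close> inverse times \<^term>\<open>\<phi> h\<close>;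
  taking for \<^term>\<open>C\<close> the preimage of \<^term>\<open>A\<close> under the representative of \<^term>\<open>\<phi> g\<close> and pulling
  back once more turns this into a comparison of the two preimages of \<^term>\<open>A\<close>.
\<close>

lemma boolean_action_imp_near_action:
  assumes M: "prob_space M" and tg: "topological_group G T" and act: "boolean_action G T M \<phi>"
  defines "t \<equiv> \<lambda>g. SOME f. f \<in> \<phi> g"
  shows "near_action M G T t"
proof -
  have hom: "\<phi> \<in> hom G (Aut M)" and cont: "continuous_map T (Aut_topology M) \<phi>"
    using act by (auto simp: boolean_action_def)
  have G: "group G" and sp: "topspace T = carrier G" using tg by (auto simp: topological_group_def)
  interpret prob_space M by (rule M)
  interpret A: group "Aut M" by (rule group_Aut)
  have \<phi>C: "\<phi> g \<in> carrier (Aut M)" if "g \<in> carrier G" for g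
    using hom that by (auto simp: hom_def)
  have rep: "(SOME f. f \<in> a) \<in> a" if "a \<in> carrier (Aut M)" for a
  proof -
    have "a \<noteq> {}" using that in_quotient_imp_non_empty[OF equiv_mpt_rel] by (simp add: Aut_def)
    then show ?thesis by (simp add: some_in_eq)
  qed
  have class_eq: "a = mpt_rel M `` {f}" if "a \<in> carrier (Aut M)" "f \<in> a" for a f
    using that equiv_mpt_rel by (auto simp: Aut_def quotient_def dest: equiv_class_eq)
  have mem: "f \<in> mpt M" if "a \<in> carrier (Aut M)" "f \<in> a" for a f
    using that in_quotient_imp_subset[OF equiv_mpt_rel] by (auto simp: Aut_def)
  have tr: "t g \<in> \<phi> g" if "g \<in> carrier G" for g using rep[OF \<phi>C[OF that]] by (simp add: t_def)
  have mult: "AE x in M. f x = f1 (f2 x)"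
    if "a \<in> carrier (Aut M)" "b \<in> carrier (Aut M)" "f \<in> a \<otimes>\<^bsub>Aut M\<^esub> b" "f1 \<in> a" "f2 \<in> b"
    for a b f f1 f2
  proof -
    have "a \<otimes>\<^bsub>Aut M\<^esub> b = mpt_rel M `` {f1 \<circ> f2}"
      using Aut_mult[OF mem[OF that(1,4)] mem[OF that(2,5)]] class_eq[OF that(1,4)]
        class_eq[OF that(2,5)] by simp
    then have "AE x in M. (f1 \<circ> f2) x = f x" using that(3) by (auto simp: mpt_rel_def)
    then show ?thesis by eventually_elim simp
  qed
  show ?thesis
  proof
    show "topological_group G T" by (rule tg)
    show "t g \<in> mpt M" if "g \<in> carrier G" for g
      using mem[OF \<phi>C[OF that] tr[OF that]] .
    show "AE x in M. t (g \<otimes>\<^bsub>G\<^esub> h) x = t g (t h x)"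
      if "g \<in> carrier G" "h \<in> carrier G" for g h
    proof (rule mult[OF \<phi>C[OF that(1)] \<phi>C[OF that(2)] _ tr[OF that(1)] tr[OF that(2)]])
      have "g \<otimes>\<^bsub>G\<^esub> h \<in> carrier G" using G that by (simp add: group.is_monoid monoid.m_closed)
      then show "t (g \<otimes>\<^bsub>G\<^esub> h) \<in> \<phi> g \<otimes>\<^bsub>Aut M\<^esub> \<phi> h"
        using tr hom_mult[OF hom that] by auto
    qed
    show "openin T {h \<in> carrier G. prob (sym_diff (t h -` A \<inter> space M) (t g -` A \<inter> space M)) < e}"
      if A: "A \<in> sets M" and g: "g \<in> carrier G" and e: "0 < e" for A g e
    proof -
      define C where "C = t g -` A \<inter> space M"
      have tgm: "t g \<in> mpt M" using mem[OF \<phi>C[OF g] tr[OF g]] .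
      have C: "C \<in> sets M" using tgm A by (auto simp: mpt_def C_def)
      let ?W = "\<phi> g <#\<^bsub>Aut M\<^esub> aut_nhd M C e"
      have "openin (Aut_topology M) ?W"
        unfolding Aut_topology_def
        by (rule topology_generated_by_Basis) (use \<phi>C[OF g] C e in blast)
      then have "openin T {h \<in> topspace T. \<phi> h \<in> ?W}"
        using cont by (rule openin_continuous_map_preimage[rotated])
      moreover have "\<phi> h \<in> ?W \<longleftrightarrow> prob (sym_diff (t h -` A \<inter> space M) C) < e"
        if h: "h \<in> carrier G" for h
      proof -
        have *: "prob (sym_diff C (aut_image a C)) = prob (sym_diff (t h -` A \<inter> space M) C)"
          if a: "a \<in> carrier (Aut M)" "\<phi> h = \<phi> g \<otimes>\<^bsub>Aut M\<^esub> a" for a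
        proof -
          define f where "f = (SOME f. f \<in> a)"
          have fa: "f \<in> a" using rep[OF a(1)] by (simp add: f_def)
          have fm: "f \<in> mpt M" using mem[OF a(1) fa] .
          have th: "t h \<in> mpt M" using mem[OF \<phi>C[OF h] tr[OF h]] .
          have AE: "AE x in M. t h x = t g (f x)"
            using mult[OF \<phi>C[OF g] a(1) _ tr[OF g] fa] tr[OF h] a(2) by simp
          have "prob (sym_diff C (aut_image a C)) = prob (sym_diff (f -` C \<inter> space M) C)"
            using measure_sym_diff_mpt_image[OF fm C C] by (simp add: aut_image_def f_def)
          also have "\<dots> = prob (sym_diff (t h -` A \<inter> space M) C)"
          proof (rule finite_measure_eq_AE)
            have fmeas: "f \<in> measurable M M" "t h \<in> measurable M M"
              using fm th by (auto simp: mpt_def)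
            show "AE x in M. x \<in> sym_diff (f -` C \<inter> space M) C \<longleftrightarrow>
                x \<in> sym_diff (t h -` A \<inter> space M) C"
              using AE AE_space
              by eventually_elim (use measurable_space[OF fmeas(1)] in \<open>auto simp: C_def\<close>)
            show "sym_diff (f -` C \<inter> space M) C \<in> sets M" "sym_diff (t h -` A \<inter> space M) C \<in> sets M"
              using measurable_sets[OF fmeas(1) C] measurable_sets[OF fmeas(2) A] C by auto
          qed
          finally show ?thesis .
        qed
        define a where "a = inv\<^bsub>Aut M\<^esub> (\<phi> g) \<otimes>\<^bsub>Aut M\<^esub> \<phi> h"
        have a: "a \<in> carrier (Aut M)" "\<phi> h = \<phi> g \<otimes>\<^bsub>Aut M\<^esub> a"
          using \<phi>C[OF g] \<phi>C[OF h] by (auto simp: a_def A.m_assoc[symmetric])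
        show ?thesis
        proof
          assume "\<phi> h \<in> ?W"
          then obtain b where "b \<in> aut_nhd M C e" "\<phi> h = \<phi> g \<otimes>\<^bsub>Aut M\<^esub> b"
            by (auto simp: l_coset_def)
          then show "prob (sym_diff (t h -` A \<inter> space M) C) < e"
            using *[of b] by (simp add: aut_nhd_def)
        next
          assume "prob (sym_diff (t h -` A \<inter> space M) C) < e"
          then have "a \<in> aut_nhd M C e" using *[OF a] a(1) by (simp add: aut_nhd_def)
          then show "\<phi> h \<in> ?W" unfolding l_coset_def a(2) by blast
        qed
      qed
      then have "{h \<in> topspace T. \<phi> h \<in> ?W}
          = {h \<in> carrier G. prob (sym_diff (t h -` A \<inter> space M) (t g -` A \<inter> space M)) < e}"
        by (auto simp: sp C_def)
      ultimately show ?thesis by simp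
    qed
  qed
qed

theorem theorem2p11:
  fixes G :: "('g, 'b) monoid_scheme"
    and T :: "'g topology"
    and M :: "'x measure"
    and \<phi> :: "'g \<Rightarrow> ('x \<Rightarrow> 'x) set"
  assumes "polish_group G T"
    and "levy_group G T"
    and "prob_space M"
    and "standard_borel M"
    and "boolean_action G T M \<phi>"
    and "ergodic_action G M \<phi>"
  shows "whirly_action G T M \<phi>"
proof -
  define t where "t g = (SOME f. f \<in> \<phi> g)" for g
  have img: "aut_image (\<phi> g) A = t g ` A" for g A by (simp add: aut_image_def t_def)
  have tg: "topological_group G T" using assms(1) by (simp add: polish_group_def)
  interpret near_action M G T t
    unfolding t_def using assms(3) tg assms(5) by (rule boolean_action_imp_near_action)
  have erg: "prob A = 0 \<or> prob A = 1"
    if A: "A \<in> sets M" and inv: "\<And>g. g \<in> carrier G \<Longrightarrow> prob (sym_diff (pre g A) A) = 0" for A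
  proof -
    have "prob (sym_diff (aut_image (\<phi> g) A) A) = 0" if g: "g \<in> carrier G" for g
    proof -
      have "sym_diff (aut_image (\<phi> g) A) A = sym_diff A (t g ` A)" using img by blast
      then show ?thesis
        using measure_sym_diff_mpt_image[OF t_mpt[OF g] A A] inv[OF g] by simp
    qed
    then show ?thesis using assms(6) A by (auto simp: ergodic_action_def)
  qed
  show ?thesis
    unfolding whirly_action_def
  proof (intro ballI impI allI)
    fix A B U
    assume AB: "A \<in> sets M" "B \<in> sets M" "0 < prob A" "0 < prob B"
      and U: "openin T U \<and> \<one>\<^bsub>G\<^esub> \<in> U"
    then obtain g where g: "g \<in> U" "0 < prob (pre g A \<inter> B)"
      using levy_imp_whirly[OF assms(2) erg, of A B U] by blast
    then have "g \<in> carrier G" using U openin_subset topspace_eq by blast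
    then show "\<exists>g\<in>U. 0 < prob (A \<inter> aut_image (\<phi> g) B)"
      using g measure_Int_mpt_image[OF t_mpt AB(1,2), of g] img by (intro bexI[of _ g]) auto
  qed
qed
end
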